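(* Let $p,s,t$ be positive integers with $t(t-2)\le s\le t^2$ and $s+t-1\le p$. Then $$\varrho_p(p+s+t-1)\le \frac{s}{p}\left(1-\frac1t\right).$$
   Context: For a graph $G$, $\alpha_p(G)$ is the maximum size of a vertex set $U$ such that $G[U]$ contains no $K_p$. $\mathsf{RT}_p(n,K_q,m)$ is the maximum number of edges in an $n$-vertex $K_q$-free graph $G$ with $\alpha_p(G)\le m$, and $\varrho_p(q):=\lim_{\varepsilon\to0}\lim_{n\to\infty}\mathsf{RT}_p(n,K_q,\varepsilon n)/\binom n2$. *)

theory Defs
  imports "HOL-Analysis.Analysis" "HOL-Library.Ramsey"
begin

text \<open>A finite simple graph is given by a finite vertex set \<open>V\<close> and an edge set
  \<open>E \<subseteq> [V]\<^bsup>2\<^esup>\<close>.\<close>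

definition sgraph :: "'a set \<Rightarrow> 'a set set \<Rightarrow> bool" where
  "sgraph V E \<longleftrightarrow> finite V \<and> E \<subseteq> [V]\<^bsup>2\<^esup>"

definition induced :: "'a set set \<Rightarrow> 'a set \<Rightarrow> 'a set set" where
  "induced E U = E \<inter> [U]\<^bsup>2\<^esup>"

definition K_free :: "nat \<Rightarrow> 'a set \<Rightarrow> 'a set set \<Rightarrow> bool" where
  "K_free q V E \<longleftrightarrow> \<not> (\<exists>K \<in> [V]\<^bsup>q\<^esup>. clique K E)"

text \<open>For \<open>p \<ge> 1\<close> and finite \<open>V\<close> the maximum is over a finite set that is nonempty
  (take \<open>U = {}\<close>).\<close>

definition alpha :: "nat \<Rightarrow> 'a set \<Rightarrow> 'a set set \<Rightarrow> nat" where
  "alpha p V E = Max {card U | U. U \<subseteq> V \<and> K_free p U (induced E U)}"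

text \<open>Graphs on \<open>n\<close> vertices are taken on the vertex set \<open>{..<n}\<close>. The bound \<open>m\<close> is real,
  since it is used with \<open>m = \<epsilon> n\<close>. On finite sets of naturals \<open>Sup\<close> is the maximum; if no
  admissible graph exists, which can happen when \<open>m\<close> is small, the value is \<open>0\<close>.\<close>

definition RT :: "nat \<Rightarrow> nat \<Rightarrow> nat \<Rightarrow> real \<Rightarrow> nat" where
  "RT p n q m = Sup {card E | E :: nat set set.
     sgraph {..<n} E \<and> K_free q {..<n} E \<and> real (alpha p {..<n} E) \<le> m}"

definition RT_density :: "nat \<Rightarrow> nat \<Rightarrow> real" where
  "RT_density p q =
     Lim (at_right 0) (\<lambda>\<epsilon>::real. lim (\<lambda>n. real (RT p n q (\<epsilon> * real n)) / real (n choose 2)))"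

end

(* With \<alpha>_p(G) = o(n) every linear set of vertices contains a K_p. Start with K copies of the
   vertex set and shrink them to sets W_1, ..., W_K of linear size that maximise the sum of the
   densities, plus a small multiple of the sum of squared densities, plus a tiny multiple of the
   sum of ln |W_i|. Splitting two of the sets cannot increase this functional, which forces all
   pairs to be regular, while the densities still add up to at least those of G. So no regularity
   lemma for partitions is needed.

   Round p times the density of a pair up to an integer weight w. If k of the sets have pairwise
   positive weights and one of these weights is w, pick single vertices from k - 2 sets, a K_p Q in
   one of the other two and a K_p in the common neighbourhood of w vertices of Q in the last one:
   this gives a clique of order p + w + k - 2. Since G has no clique of order p + s + t - 1, weights
   within k such sets are at most s + t - k, and the Motzkin-Straus argument bounds the total weight
   by the maximum of (s + t - k)(1 - 1/k) over k, attained at k = t.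

   The limits in the definition must be shown to exist. If for some \<epsilon> no graph has
   \<alpha>_p(H) < \<epsilon>|H|, all smaller \<epsilon> admit no graph and the density is 0. Otherwise blow up a
   near-optimal graph and add boundedly many copies of such an H, whose slack pays for the vertices
   left over by divisibility; this gives convergence for every \<epsilon>. *)

theory Submission
  imports Defs "HOL-Real_Asymp.Real_Asymp"
begin

section \<open>Maximising quadratic forms of weighted graphs\<close>

section \<open>A weighted Turan bound\<close>

text \<open>The right side minus the left side is
  \<open>(k - t) * (k * t - s - t) / (k * t)\<close>. The two factors never have opposite signs:
  \<open>k \<le> t - 1\<close> gives \<open>k * t \<le> t * (t - 1) \<le> s + t\<close>, and
  \<open>k \<ge> t + 1\<close> gives \<open>k * t \<ge> t * (t + 1) \<ge> s + t\<close>. These are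
  exactly the two bounds on \<open>s\<close>.\<close>

lemma turan_parameter_bound:
  fixes s t k :: nat
  assumes "k > 0" "t > 0" "int t * (int t - 2) \<le> int s" "s \<le> t\<^sup>2"
  shows "(real s + real t - real k) * (1 - 1 / real k) \<le> real s * (1 - 1 / real t)"
proof -
  have "(int k - int t) * (int k * int t - int s - int t) \<ge> 0"
  proof (cases k t rule: linorder_cases)
    case less
    then have "int k * int t \<le> (int t - 1) * int t"
      by (intro mult_right_mono) auto
    with assms(3) less show ?thesis
      by (intro mult_nonpos_nonpos) (auto simp: algebra_simps)
  next
    case greater
    then have "(int t + 1) * int t \<le> int k * int t"
      by (intro mult_right_mono) auto
    moreover have "int s \<le> int t * int t"
      using assms(4) by (metis of_nat_le_iff of_nat_mult power2_eq_square)
    ultimately show ?thesis using greater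
      by (intro mult_nonneg_nonneg) (auto simp: algebra_simps)
  qed auto
  then have "real_of_int ((int k - int t) * (int k * int t - int s - int t)) \<ge> 0"
    by (simp only: of_int_0_le_iff)
  then have "(real k - real t) * (real k * real t - real s - real t) / (real k * real t) \<ge> 0"
    by simp
  also have "(real k - real t) * (real k * real t - real s - real t) / (real k * real t)
      = real s * (1 - 1 / real t) - (real s + real t - real k) * (1 - 1 / real k)"
    using assms(1,2) by (simp add: field_simps)
  finally show ?thesis by simp
qed

text \<open>With zero diagonal the form is affine in the single variable \<open>x j\<close>, and
  symmetry produces the factor 2. This exposes the effect of moving mass between two
  indices.\<close>

lemma sum_offdiag_remove:
  fixes x :: "'i \<Rightarrow> real"
  assumes "finite S" "j \<in> S" "\<And>i. g i i = 0" "\<And>i k. g i k = g k i"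
  shows "(\<Sum>i\<in>S. \<Sum>k\<in>S. g i k * x i * x k)
    = (\<Sum>i\<in>S-{j}. \<Sum>k\<in>S-{j}. g i k * x i * x k) + 2 * x j * (\<Sum>k\<in>S-{j}. g j k * x k)"
proof -
  have "(\<Sum>i\<in>S. \<Sum>k\<in>S. g i k * x i * x k)
    = (\<Sum>k\<in>S. g j k * x j * x k) + (\<Sum>i\<in>S-{j}. \<Sum>k\<in>S. g i k * x i * x k)"
    by (rule sum.remove[OF assms(1,2)])
  also have "(\<Sum>k\<in>S. g j k * x j * x k) = x j * (\<Sum>k\<in>S-{j}. g j k * x k)"
    using assms by (simp add: sum.remove[of S j] sum_distrib_left mult_ac)
  also have "(\<Sum>i\<in>S-{j}. \<Sum>k\<in>S. g i k * x i * x k)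
    = (\<Sum>i\<in>S-{j}. g i j * x i * x j + (\<Sum>k\<in>S-{j}. g i k * x i * x k))"
    by (intro sum.cong refl) (rule sum.remove[OF assms(1,2)])
  also have "\<dots> = x j * (\<Sum>i\<in>S-{j}. g j i * x i) + (\<Sum>i\<in>S-{j}. \<Sum>k\<in>S-{j}. g i k * x i * x k)"
  proof -
    have "g i j * x i * x j = x j * (g j i * x i)" for i
      by (subst assms(4)) simp
    then show ?thesis by (simp only: sum.distrib sum_distrib_left)
  qed
  finally show ?thesis by simp
qed

text \<open>Motzkin and Straus: if \<open>g i j = 0\<close>, the form is linear along the direction that moves mass
  between \<open>i\<close> and \<open>j\<close>, so one of the two vertices can be discarded; this ends at a clique.\<close>

lemma weighted_turan:
  fixes g :: "'i \<Rightarrow> 'i \<Rightarrow> real" and x :: "'i \<Rightarrow> real"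
  assumes sym: "\<And>i k. g i k = g k i" and diag: "\<And>i. g i i = 0"
    and clq: "\<And>C. C \<subseteq> S \<Longrightarrow> finite C \<Longrightarrow> C \<noteq> {} \<Longrightarrow> (\<And>i j. i \<in> C \<Longrightarrow> j \<in> C \<Longrightarrow> i \<noteq> j \<Longrightarrow> g i j \<noteq> 0) \<Longrightarrow>
        \<exists>c\<ge>0. (\<forall>i\<in>C. \<forall>j\<in>C. i \<noteq> j \<longrightarrow> g i j \<le> c) \<and> c * (1 - 1 / real (card C)) \<le> b"
    and fin: "finite S" and b: "b \<ge> 0" and x: "\<And>i. i \<in> S \<Longrightarrow> x i \<ge> 0"
  shows "(\<Sum>i\<in>S. \<Sum>k\<in>S. g i k * x i * x k) \<le> b * (\<Sum>i\<in>S. x i)\<^sup>2"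
  using fin clq x
proof (induction "card S" arbitrary: S x)
  case 0
  then show ?case by simp
next
  case (Suc m)
  show ?case
  proof (cases "\<exists>i\<in>S. \<exists>j\<in>S. i \<noteq> j \<and> g i j = 0")
    case True
    define L where "L i = (\<Sum>k\<in>S. g i k * x k)" for i
    \<comment> \<open>\<open>L\<close> is half the gradient of the form. Labelling the pair so that
      \<open>L j \<le> L i\<close> makes the move of mass from \<open>j\<close> to \<open>i\<close>
      harmless.\<close>
    obtain i j where ij: "i \<in> S" "j \<in> S" "i \<noteq> j" "g i j = 0" "L j \<le> L i"
      using True sym by (metis linear)
    define y where "y = x(i := x i + x j)"
    have fin': "finite (S - {j} - {i})" "i \<in> S - {j}" using Suc.prems(1) ij by auto
    have Li: "L i = (\<Sum>k\<in>S-{j}-{i}. g i k * x k)" "L j = (\<Sum>k\<in>S-{j}-{i}. g j k * x k)"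
      unfolding L_def using Suc.prems(1) ij diag sym[of j i]
      by (auto simp: sum.remove[of S j] sum.remove[of "S-{j}" i])
    have Lj: "(\<Sum>k\<in>S-{j}. g j k * x k) = L j"
      using Suc.prems(1) ij diag unfolding L_def by (simp add: sum.remove[of S j])
    have 1: "(\<Sum>i\<in>S. \<Sum>k\<in>S. g i k * x i * x k) =
      (\<Sum>u\<in>S-{j}-{i}. \<Sum>k\<in>S-{j}-{i}. g u k * x u * x k) + 2 * x i * L i + 2 * x j * L j"
      using sum_offdiag_remove[of S j g x, OF Suc.prems(1) ij(2) diag sym]
        sum_offdiag_remove[of "S-{j}" i g x, OF _ fin'(2) diag sym, OF finite_Diff[OF Suc.prems(1)]]
      unfolding Lj Li(1)[symmetric] by linarith
    have Ly: "(\<Sum>k\<in>S-{j}-{i}. g i k * y k) = L i"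
      unfolding Li by (intro sum.cong) (auto simp: y_def)
    have My: "(\<Sum>u\<in>S-{j}-{i}. \<Sum>k\<in>S-{j}-{i}. g u k * y u * y k)
      = (\<Sum>u\<in>S-{j}-{i}. \<Sum>k\<in>S-{j}-{i}. g u k * x u * x k)"
      by (intro sum.cong) (auto simp: y_def)
    have 2: "(\<Sum>i\<in>S-{j}. \<Sum>k\<in>S-{j}. g i k * y i * y k) =
      (\<Sum>u\<in>S-{j}-{i}. \<Sum>k\<in>S-{j}-{i}. g u k * x u * x k) + 2 * (x i + x j) * L i"
      using sum_offdiag_remove[of "S-{j}" i g y, OF _ fin'(2) diag sym, OF finite_Diff[OF Suc.prems(1)]]
      unfolding Ly My by (simp add: y_def)
    have aux: "a + 2 * u * l + 2 * v * l' \<le> a + 2 * (u + v) * l" if "v * l' \<le> v * l"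
      for a u v l l' :: real
      using that by (simp add: algebra_simps)
    have "x j * L j \<le> x j * L i"
      using ij Suc.prems(3) by (intro mult_left_mono) auto
    then have "(\<Sum>i\<in>S. \<Sum>k\<in>S. g i k * x i * x k) \<le> (\<Sum>i\<in>S-{j}. \<Sum>k\<in>S-{j}. g i k * y i * y k)"
      unfolding 1 2 by (rule aux)
    also have "\<dots> \<le> b * (\<Sum>i\<in>S-{j}. y i)\<^sup>2"
    proof (rule Suc.hyps)
      show "m = card (S - {j})" using Suc.hyps(2) Suc.prems(1) ij by simp
      show "finite (S - {j})" using Suc.prems(1) by simp
      show "\<And>k. k \<in> S - {j} \<Longrightarrow> 0 \<le> y k" using Suc.prems(3) ij by (auto simp: y_def)
      show "\<exists>c\<ge>0. (\<forall>i\<in>C. \<forall>j\<in>C. i \<noteq> j \<longrightarrow> g i j \<le> c) \<and> c * (1 - 1 / real (card C)) \<le> b"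
        if "C \<subseteq> S - {j}" "finite C" "C \<noteq> {}"
          "\<And>i j. i \<in> C \<Longrightarrow> j \<in> C \<Longrightarrow> i \<noteq> j \<Longrightarrow> g i j \<noteq> 0" for C
        by (rule Suc.prems(2)) (use that in auto)
    qed
    also have "(\<Sum>i\<in>S-{j}. y i) = (\<Sum>i\<in>S. x i)"
    proof -
      have "(\<Sum>i\<in>S-{j}. y i) = y i + (\<Sum>k\<in>S-{j}-{i}. y k)"
        using Suc.prems(1) ij by (intro sum.remove) auto
      also have "(\<Sum>k\<in>S-{j}-{i}. y k) = (\<Sum>k\<in>S-{j}-{i}. x k)"
        by (intro sum.cong) (auto simp: y_def)
      also have "y i + \<dots> = (\<Sum>i\<in>S. x i)"
        using Suc.prems(1) ij by (simp add: y_def sum.remove[of S j] sum.remove[of "S-{j}" i])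
      finally show ?thesis .
    qed
    finally show ?thesis .
  next
    case False
    have "S \<noteq> {}" using Suc.hyps(2) by auto
    then have "\<exists>c\<ge>0. (\<forall>i\<in>S. \<forall>j\<in>S. i \<noteq> j \<longrightarrow> g i j \<le> c) \<and> c * (1 - 1 / real (card S)) \<le> b"
      by (intro Suc.prems(2)) (use Suc.prems(1) False in auto)
    then obtain c where c: "c \<ge> 0" "\<And>i j. i \<in> S \<Longrightarrow> j \<in> S \<Longrightarrow> i \<noteq> j \<Longrightarrow> g i j \<le> c"
      and cb: "c * (1 - 1 / real (card S)) \<le> b" by blast
    let ?X = "\<Sum>i\<in>S. x i"
    \<comment> \<open>All of \<open>S\<close> is now a clique, so every off-diagonal weight may be
      raised to \<open>c\<close>; the subtracted term removes the diagonal.\<close>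
    have "(\<Sum>i\<in>S. \<Sum>k\<in>S. g i k * x i * x k) \<le> (\<Sum>i\<in>S. \<Sum>k\<in>S. c * (x i * x k) - (if k = i then c * (x i)\<^sup>2 else 0))"
    proof (intro sum_mono)
      fix i k assume *: "i \<in> S" "k \<in> S"
      show "g i k * x i * x k \<le> c * (x i * x k) - (if k = i then c * (x i)\<^sup>2 else 0)"
      proof (cases "i = k")
        case False
        have "g i k * (x i * x k) \<le> c * (x i * x k)"
          using * False c(2) Suc.prems(3) by (intro mult_right_mono) auto
        then show ?thesis using False by (simp add: mult.assoc)
      qed (simp add: diag power2_eq_square)
    qed
    also have "\<dots> = c * (?X\<^sup>2 - (\<Sum>i\<in>S. (x i)\<^sup>2))"
    proof -
      have "(\<Sum>i\<in>S. \<Sum>k\<in>S. c * (x i * x k)) = c * ?X\<^sup>2"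
        unfolding power2_eq_square sum_product by (simp only: sum_distrib_left)
      moreover have "(\<Sum>i\<in>S. \<Sum>k\<in>S. if k = i then c * (x i)\<^sup>2 else 0) = c * (\<Sum>i\<in>S. (x i)\<^sup>2)"
        using Suc.prems(1) by (simp add: sum_distrib_left)
      ultimately show ?thesis by (simp add: sum_subtractf right_diff_distrib)
    qed
    \<comment> \<open>Cauchy-Schwarz: the form with constant weights is largest when the mass is
      spread evenly.\<close>
    also have "\<dots> \<le> c * (?X\<^sup>2 - ?X\<^sup>2 / card S)"
    proof -
      have "?X\<^sup>2 \<le> card S * (\<Sum>i\<in>S. (x i)\<^sup>2)"
        using sum_squared_le_sum_of_squares[of x S] by (simp add: mult.commute)
      moreover have "card S > 0" using Suc.hyps(2) by simp
      ultimately have "?X\<^sup>2 / card S \<le> (\<Sum>i\<in>S. (x i)\<^sup>2)"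
        by (simp add: field_simps)
      then show ?thesis using c(1) by (intro mult_left_mono) auto
    qed
    also have "\<dots> = c * (1 - 1 / real (card S)) * ?X\<^sup>2" by (simp add: algebra_simps)
    also have "\<dots> \<le> b * ?X\<^sup>2" using cb by (intro mult_right_mono) auto
    finally show ?thesis .
  qed
qed

section \<open>Edge densities and regular tuples of overlapping sets\<close>

section \<open>Regular tuples\<close>

text \<open>Ordered pairs are counted, so an edge inside \<open>A \<inter> B\<close> counts twice.
  Overlaps matter because the members of a regular tuple are arbitrary subsets of one vertex
  set.\<close>

definition ecount :: "'a set set \<Rightarrow> 'a set \<Rightarrow> 'a set \<Rightarrow> real" where
  "ecount E A B = (\<Sum>a\<in>A. \<Sum>b\<in>B. of_bool ({a, b} \<in> E))"

definition edge_density :: "'a set set \<Rightarrow> 'a set \<Rightarrow> 'a set \<Rightarrow> real" where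
  "edge_density E A B = ecount E A B / (real (card A) * real (card B))"

lemma ecount_commute: "ecount E A B = ecount E B A"
  unfolding ecount_def by (subst sum.swap) (simp add: insert_commute)

lemma ecount_nonneg: "ecount E A B \<ge> 0"
  unfolding ecount_def by (intro sum_nonneg) auto

lemma ecount_le: "ecount E A B \<le> real (card A) * real (card B)"
proof -
  have "ecount E A B \<le> (\<Sum>a\<in>A. \<Sum>b\<in>B. 1)"
    unfolding ecount_def by (intro sum_mono) auto
  then show ?thesis by simp
qed

lemma ecount_split:
  assumes "finite W" "A \<subseteq> W"
  shows "ecount E A B + ecount E (W - A) B = ecount E W B"
    and "ecount E B A + ecount E B (W - A) = ecount E B W"
proof -
  show 1: "ecount E A B + ecount E (W - A) B = ecount E W B"
    unfolding ecount_def
    using sum.subset_diff[OF assms(2,1), of "\<lambda>a. \<Sum>b\<in>B. of_bool ({a, b} \<in> E) :: real"] by simp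
  then show "ecount E B A + ecount E B (W - A) = ecount E B W"
    by (simp add: ecount_commute)
qed

lemma edge_density_nonneg: "edge_density E A B \<ge> 0"
  by (simp add: edge_density_def ecount_nonneg)

lemma edge_density_le_1: "edge_density E A B \<le> 1"
  using ecount_le[of E A B] unfolding edge_density_def
  by (metis divide_le_eq_1 mult_nonneg_nonneg of_nat_0_le_iff order_le_less divide_eq_0_iff zero_le_one)

lemma edge_density_commute: "edge_density E A B = edge_density E B A"
  by (simp add: edge_density_def ecount_commute[of E A B] mult.commute)

lemma ecount_self:
  assumes "sgraph V E"
  shows "ecount E V V = 2 * real (card E)"
proof -
  have fin: "finite V" "E \<subseteq> [V]\<^bsup>2\<^esup>" using assms by (auto simp: sgraph_def)
  then have finE: "finite E" using finite_imp_finite_nsets finite_subset by blast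
  have 1: "(\<Sum>a\<in>V. \<Sum>b\<in>V. of_bool ({a,b} = e)) = (2::real)" if "e \<in> E" for e
  proof -
    obtain x y where xy: "e = {x, y}" "x \<noteq> y" "x \<in> V" "y \<in> V"
      using fin(2) \<open>e \<in> E\<close> by (meson nsets2_E subsetD)
    have "(\<Sum>a\<in>V. \<Sum>b\<in>V. of_bool ({a,b} = e)) = (\<Sum>ab\<in>V\<times>V. of_bool ({fst ab, snd ab} = e) :: real)"
      by (simp add: sum.cartesian_product case_prod_unfold)
    also have "\<dots> = real (card {ab \<in> V \<times> V. {fst ab, snd ab} = e})"
      using fin(1) by (simp add: Int_def)
    also have "{ab \<in> V \<times> V. {fst ab, snd ab} = e} = {(x, y), (y, x)}"
      using xy by (auto simp: doubleton_eq_iff)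
    finally show ?thesis using xy(2) by simp
  qed
  have "ecount E V V = (\<Sum>a\<in>V. \<Sum>b\<in>V. \<Sum>e\<in>E. of_bool ({a,b} = e))"
    unfolding ecount_def using finE by (intro sum.cong refl) (simp add: of_bool_def)
  also have "\<dots> = (\<Sum>a\<in>V. \<Sum>e\<in>E. \<Sum>b\<in>V. of_bool ({a,b} = e))"
    by (intro sum.cong refl sum.swap)
  also have "\<dots> = (\<Sum>e\<in>E. \<Sum>a\<in>V. \<Sum>b\<in>V. of_bool ({a,b} = e))"
    by (rule sum.swap)
  also have "\<dots> = (\<Sum>e\<in>E. 2)" using 1 by (intro sum.cong) auto
  finally show ?thesis by simp
qed

text \<open>This is the functional to be maximised without its logarithmic term. The linear part
  preserves the density of the graph, and the quadratic part rewards irregular splits.\<close>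

definition index_sum :: "'a set set \<Rightarrow> real \<Rightarrow> nat \<Rightarrow> (nat \<Rightarrow> 'a set) \<Rightarrow> real" where
  "index_sum E \<gamma> K W = (\<Sum>k<K. \<Sum>l\<in>{..<K}-{k}. edge_density E (W k) (W l) + \<gamma> * (edge_density E (W k) (W l))\<^sup>2)"

text \<open>The gain of a quadratic function over its value at the mean is \<open>\<gamma>\<close>
  times the variance.\<close>

lemma jensen_gap:
  fixes P z :: "'i \<Rightarrow> real"
  assumes "finite I" "(\<Sum>i\<in>I. P i) = 1" "(\<Sum>i\<in>I. P i * z i) = m" 
  shows "(\<Sum>i\<in>I. P i * (z i + \<gamma> * (z i)\<^sup>2)) = m + \<gamma> * m\<^sup>2 + \<gamma> * (\<Sum>i\<in>I. P i * (z i - m)\<^sup>2)"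
proof -
  have "(\<Sum>i\<in>I. P i * (z i - m)\<^sup>2) = (\<Sum>i\<in>I. P i * (z i)\<^sup>2) - 2 * m * (\<Sum>i\<in>I. P i * z i) + m\<^sup>2 * (\<Sum>i\<in>I. P i)"
    by (simp add: power2_diff sum.distrib sum_subtractf sum_distrib_left sum_distrib_right algebra_simps)
  then have "(\<Sum>i\<in>I. P i * (z i - m)\<^sup>2) = (\<Sum>i\<in>I. P i * (z i)\<^sup>2) - m\<^sup>2"
    by (simp add: assms power2_eq_square)
  moreover have "(\<Sum>i\<in>I. P i * (z i + \<gamma> * (z i)\<^sup>2)) = m + \<gamma> * (\<Sum>i\<in>I. P i * (z i)\<^sup>2)"
    by (simp add: assms(3)[symmetric] sum.distrib sum_distrib_left algebra_simps)
  ultimately show ?thesis by (simp add: right_diff_distrib)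
qed


section \<open>Random splitting of two sets of a tuple\<close>

lemma sum_bool_pair:
  "(\<Sum>z\<in>UNIV. f z) = f (True, True) + f (True, False) + f (False, True) + (f (False, False) :: real)"
  by (simp add: UNIV_Times_UNIV[symmetric] sum.cartesian_product[symmetric] UNIV_bool del: UNIV_Times_UNIV)

lemma finite_PiE_nonempty_subsets: "finite V \<Longrightarrow> finite (PiE {..<K::nat} (\<lambda>_. Pow V - {{}}))"
  by (intro finite_PiE) auto

lemma weights_split:
  assumes "finite W" "W \<noteq> {}" "A \<subseteq> W"
  shows "real (card A) / real (card W) + real (card (W - A)) / real (card W) = 1"
proof -
  have "real (card A) + real (card (W - A)) = real (card W)"
    using assms(1,3) by (metis card_Un_disjoint Diff_disjoint Un_Diff_cancel Un_absorb1 finite_subset finite_Diff of_nat_add)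
  moreover have "real (card W) > 0" using assms(1,2) by (simp add: card_gt_0_iff)
  ultimately show ?thesis by (simp add: add_divide_distrib[symmetric])
qed

text \<open>The loss is the entropy of a two-part split. The inequality
  \<open>ln y \<le> y - 1\<close> at \<open>y = 1 / \<alpha> x\<close> gives
  \<open>\<alpha> x * ln (\<alpha> x) \<ge> \<alpha> x - 1\<close>, and the two such bounds add up
  to \<open>-1\<close>. An empty part has weight 0, which cancels the value of
  \<open>ln 0\<close>.\<close>

lemma mean_ln_card_split:
  assumes "finite W" "W \<noteq> {}" "A \<subseteq> W" "a = (\<lambda>x. if x then A else W - A)"
    and "\<alpha> = (\<lambda>x. real (card (a x)) / real (card W))"
  shows "ln (real (card W)) - 1 \<le> \<alpha> True * ln (real (card (a True))) + \<alpha> False * ln (real (card (a False)))"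
proof -
  have cW: "real (card W) > 0" using assms(1,2) by (simp add: card_gt_0_iff)
  have \<alpha>1: "\<alpha> True + \<alpha> False = 1"
    using weights_split[OF assms(1-3)] by (simp add: assms(4,5))
  have 1: "\<alpha> x * ln (real (card (a x))) \<ge> \<alpha> x * ln (real (card W)) + \<alpha> x - 1" for x
  proof (cases "card (a x) = 0")
    case False
    then have pos: "\<alpha> x > 0" "real (card (a x)) > 0" using cW by (auto simp: assms(5))
    have "ln (real (card (a x))) = ln (real (card W)) + ln (\<alpha> x)"
      using pos cW by (simp add: assms(5) ln_div)
    moreover have "\<alpha> x * ln (\<alpha> x) \<ge> \<alpha> x - 1"
    proof -
      have "ln (1 / \<alpha> x) \<le> 1 / \<alpha> x - 1" using pos(1) by (intro ln_le_minus_one) auto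
      then have "\<alpha> x * (- ln (\<alpha> x)) \<le> \<alpha> x * (1 / \<alpha> x - 1)"
        using pos(1) by (intro mult_left_mono) (auto simp: ln_div)
      then show ?thesis using pos(1) by (simp add: algebra_simps)
    qed
    ultimately show ?thesis by (simp add: algebra_simps)
  qed (simp add: assms(5))
  have "\<alpha> True * ln (real (card W)) + \<alpha> False * ln (real (card W)) = ln (real (card W))"
    using \<alpha>1 by (metis distrib_right mult_1)
  then show ?thesis using 1[of True] 1[of False] \<alpha>1 by linarith
qed

text \<open>Edge counts are additive, so with weights proportional to size the mean density is
  preserved. An empty part has density 0 by convention and also weight 0.\<close>

lemma mean_edge_density_split:
  assumes "finite W" "W \<noteq> {}" "A \<subseteq> W" "a = (\<lambda>x. if x then A else W - A)"
    and "\<alpha> = (\<lambda>x. real (card (a x)) / real (card W))"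
  shows "\<alpha> True * edge_density E (a True) X + \<alpha> False * edge_density E (a False) X = edge_density E W X"
    and "\<alpha> True * edge_density E X (a True) + \<alpha> False * edge_density E X (a False) = edge_density E X W"
proof -
  have fin: "finite (a x)" for x using assms(1,3,4) finite_subset by auto
  have 1: "\<alpha> x * edge_density E (a x) X = ecount E (a x) X / (real (card W) * real (card X))" for x
  proof (cases "card (a x) = 0")
    case True
    then have "a x = {}" using fin by simp
    then show ?thesis by (simp add: assms(5) edge_density_def ecount_def)
  qed (simp add: assms(5) edge_density_def)
  show 2: "\<alpha> True * edge_density E (a True) X + \<alpha> False * edge_density E (a False) X = edge_density E W X"
    unfolding 1 unfolding edge_density_def using ecount_split(1)[OF assms(1,3), of E X]
    by (simp add: assms(4) add_divide_distrib[symmetric])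
  then show "\<alpha> True * edge_density E X (a True) + \<alpha> False * edge_density E X (a False) = edge_density E X W"
    by (simp add: edge_density_commute)
qed

text \<open>The quadratic terms gain the squared deviation at \<open>(i, j)\<close>, and the logarithms lose at most
  one nat of entropy for each of the two splits.\<close>

lemma mean_index_split:
  fixes W :: "nat \<Rightarrow> 'a set"
  assumes ij: "i < K" "j < K" "i \<noteq> j"
    and W: "\<And>k. k < K \<Longrightarrow> finite (W k) \<and> W k \<noteq> {}"
    and AB: "A \<subseteq> W i" "B \<subseteq> W j"
    and \<gamma>: "\<gamma> \<ge> 0" and \<theta>: "\<theta> \<ge> 0"
    and a: "a = (\<lambda>x. if x then A else W i - A)" and b: "b = (\<lambda>y. if y then B else W j - B)"
    and \<alpha>: "\<alpha> = (\<lambda>x. real (card (a x)) / real (card (W i)))"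
    and \<beta>: "\<beta> = (\<lambda>y. real (card (b y)) / real (card (W j)))"
    and W': "W' = (\<lambda>z. W(i := a (fst z), j := b (snd z)))"
    and \<Phi>: "\<Phi> = (\<lambda>W. index_sum E \<gamma> K W + \<theta> * (\<Sum>k<K. ln (real (card (W k)))))"
  shows "(\<Sum>z\<in>UNIV. \<alpha> (fst z) * \<beta> (snd z) * \<Phi> (W' z))
    \<ge> \<Phi> W + \<gamma> * (\<alpha> True * \<beta> True * (edge_density E A B - edge_density E (W i) (W j))\<^sup>2) - 2 * \<theta>"
proof -
  \<comment> \<open>\<open>P\<close> is a product distribution: one part of \<open>W i\<close> and
    one part of \<open>W j\<close> are chosen independently, each with probability proportional to
    its size. \<open>W' z\<close> is the resulting random tuple.\<close>
  define P where "P z = \<alpha> (fst z) * \<beta> (snd z)" for z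
  have Wi: "finite (W i)" "W i \<noteq> {}" and Wj: "finite (W j)" "W j \<noteq> {}" using W ij by auto
  have \<alpha>1: "\<alpha> True + \<alpha> False = 1" using weights_split[OF Wi AB(1)] by (simp add: \<alpha> a)
  have \<beta>1: "\<beta> True + \<beta> False = 1" using weights_split[OF Wj AB(2)] by (simp add: \<beta> b)
  have P0: "P z \<ge> 0" for z by (simp add: P_def \<alpha> \<beta>)
  have expand: "(\<Sum>z\<in>UNIV. P z * f z) =
      \<alpha> True * (\<beta> True * f (True, True) + \<beta> False * f (True, False)) +
      \<alpha> False * (\<beta> True * f (False, True) + \<beta> False * f (False, False))" for f
    by (simp add: sum_bool_pair P_def algebra_simps)
  have only_fst: "(\<Sum>z\<in>UNIV. P z * f (fst z)) = \<alpha> True * f True + \<alpha> False * f False" for f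
    using \<beta>1 by (simp add: expand distrib_right[symmetric])
  have only_snd: "(\<Sum>z\<in>UNIV. P z * f (snd z)) = \<beta> True * f True + \<beta> False * f False" for f
    using \<alpha>1 by (simp add: expand distrib_right[symmetric])
  have P1: "(\<Sum>z\<in>UNIV. P z * c) = c" for c
    using only_fst[of "\<lambda>_. c"] \<alpha>1 by (simp add: distrib_right[symmetric])
  note di = mean_edge_density_split[OF Wi AB(1) a \<alpha>]
  note dj = mean_edge_density_split[OF Wj AB(2) b \<beta>]
  \<comment> \<open>Only the coordinates \<open>i\<close> and \<open>j\<close> are random, and they
    are independent, so the mean is preserved even for a pair in which both occur.\<close>
  have mean: "(\<Sum>z\<in>UNIV. P z * edge_density E (W' z k) (W' z l)) = edge_density E (W k) (W l)" if "k \<noteq> l" for k l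
  proof -
    consider "k = i" "l = j" | "k = j" "l = i" | "k = i" "l \<noteq> j" | "k = j" "l \<noteq> i"
      | "l = i" "k \<noteq> j" | "l = j" "k \<noteq> i" | "k \<noteq> i" "k \<noteq> j" "l \<noteq> i" "l \<noteq> j" by blast
    then show ?thesis
    proof cases
      case 1
      then show ?thesis using ij(3) by (simp add: W' expand dj di)
    next
      case 2
      then show ?thesis using ij(3) by (simp add: W' expand dj di)
    next
      case 3
      then show ?thesis using ij(3) that only_fst[of "\<lambda>x. edge_density E (a x) (W l)"] di by (simp add: W')
    next
      case 4
      then show ?thesis using ij(3) that only_snd[of "\<lambda>x. edge_density E (b x) (W l)"] dj by (simp add: W')
    next
      case 5
      then show ?thesis using ij(3) that only_fst[of "\<lambda>x. edge_density E (W k) (a x)"] di by (simp add: W')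
    next
      case 6
      then show ?thesis using ij(3) that only_snd[of "\<lambda>x. edge_density E (W k) (b x)"] dj by (simp add: W')
    next
      case 7
      then show ?thesis by (simp add: W' P1)
    qed
  qed
  define \<psi> where "\<psi> d = d + \<gamma> * d\<^sup>2" for d :: real
  define gap where "gap = \<gamma> * (\<alpha> True * \<beta> True * (edge_density E A B - edge_density E (W i) (W j))\<^sup>2)"
  \<comment> \<open>Every pair gains a nonnegative variance. The deviation \<open>gap\<close> is
    credited only to the ordered pair \<open>(i, j)\<close>, through the single outcome
    \<open>(True, True)\<close>.\<close>
  have term_ge: "(\<Sum>z\<in>UNIV. P z * \<psi> (edge_density E (W' z k) (W' z l)))
      \<ge> \<psi> (edge_density E (W k) (W l)) + (if k = i \<and> l = j then gap else 0)" if "k \<noteq> l" for k l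
  proof -
    let ?m = "edge_density E (W k) (W l)"
    have PU: "sum P UNIV = 1" using P1[of 1] by simp
    have "(\<Sum>z\<in>UNIV. P z * \<psi> (edge_density E (W' z k) (W' z l)))
        = \<psi> ?m + \<gamma> * (\<Sum>z\<in>UNIV. P z * (edge_density E (W' z k) (W' z l) - ?m)\<^sup>2)"
      unfolding \<psi>_def by (rule jensen_gap[OF _ PU mean[OF that]]) simp
    moreover have "(\<Sum>z\<in>UNIV. P z * (edge_density E (W' z k) (W' z l) - ?m)\<^sup>2) \<ge> 0"
      using P0 by (intro sum_nonneg) auto
    moreover have "(\<Sum>z\<in>UNIV. P z * (edge_density E (W' z i) (W' z j) - edge_density E (W i) (W j))\<^sup>2)
        \<ge> \<alpha> True * \<beta> True * (edge_density E A B - edge_density E (W i) (W j))\<^sup>2"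
    proof -
      have "P (True, True) * (edge_density E (W' (True, True) i) (W' (True, True) j) - edge_density E (W i) (W j))\<^sup>2
        \<le> (\<Sum>z\<in>UNIV. P z * (edge_density E (W' z i) (W' z j) - edge_density E (W i) (W j))\<^sup>2)"
        using P0 by (intro member_le_sum) auto
      then show ?thesis using ij(3) by (simp add: P_def W' a b)
    qed
    ultimately show ?thesis using \<gamma> by (auto simp: gap_def intro!: mult_left_mono)
  qed
  have "index_sum E \<gamma> K W + gap
    = (\<Sum>k<K. \<Sum>l\<in>{..<K}-{k}. \<psi> (edge_density E (W k) (W l)) + (if k = i \<and> l = j then gap else 0))"
  proof -
    have "(\<Sum>k<K. \<Sum>l\<in>{..<K}-{k}. if k = i \<and> l = j then gap else 0)
      = (\<Sum>k<K. if k = i then gap else 0)"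
      using ij by (intro sum.cong refl) (auto simp: sum.delta)
    then show ?thesis using ij by (simp add: index_sum_def \<psi>_def sum.distrib)
  qed
  also have "\<dots> \<le> (\<Sum>k<K. \<Sum>l\<in>{..<K}-{k}. \<Sum>z\<in>UNIV. P z * \<psi> (edge_density E (W' z k) (W' z l)))"
    using term_ge by (intro sum_mono) auto
  also have "\<dots> = (\<Sum>k<K. \<Sum>z\<in>UNIV. \<Sum>l\<in>{..<K}-{k}. P z * \<psi> (edge_density E (W' z k) (W' z l)))"
    by (intro sum.cong refl sum.swap)
  also have "\<dots> = (\<Sum>z\<in>UNIV. \<Sum>k<K. \<Sum>l\<in>{..<K}-{k}. P z * \<psi> (edge_density E (W' z k) (W' z l)))"
    by (rule sum.swap)
  also have "\<dots> = (\<Sum>z\<in>UNIV. P z * index_sum E \<gamma> K (W' z))"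
    by (simp add: index_sum_def \<psi>_def sum_distrib_left)
  finally have 1: "index_sum E \<gamma> K W + gap \<le> (\<Sum>z\<in>UNIV. P z * index_sum E \<gamma> K (W' z))" .

  have ln_ge: "(\<Sum>z\<in>UNIV. P z * ln (real (card (W' z k))))
      \<ge> ln (real (card (W k))) - ((if k = i then 1 else 0) + (if k = j then 1 else 0))" for k
  proof -
    consider "k = i" | "k = j" | "k \<noteq> i" "k \<noteq> j" by blast
    then show ?thesis
    proof cases
      case 1
      then show ?thesis using ij(3) only_fst[of "\<lambda>x. ln (real (card (a x)))"]
          mean_ln_card_split[OF Wi AB(1) a \<alpha>] by (simp add: W')
    next
      case 2
      then show ?thesis using ij(3) only_snd[of "\<lambda>x. ln (real (card (b x)))"]
          mean_ln_card_split[OF Wj AB(2) b \<beta>] by (simp add: W')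
    next
      case 3
      then show ?thesis by (simp add: W' P1)
    qed
  qed
  have "(\<Sum>k<K. ln (real (card (W k)))) - 2
    = (\<Sum>k<K. ln (real (card (W k))) - ((if k = i then 1 else 0) + (if k = j then 1 else 0)))"
    using ij by (simp add: sum_subtractf sum.distrib)
  also have "\<dots> \<le> (\<Sum>k<K. \<Sum>z\<in>UNIV. P z * ln (real (card (W' z k))))"
    using ln_ge by (intro sum_mono) auto
  also have "\<dots> = (\<Sum>z\<in>UNIV. P z * (\<Sum>k<K. ln (real (card (W' z k)))))"
    by (subst sum.swap) (simp add: sum_distrib_left)
  finally have "\<theta> * ((\<Sum>k<K. ln (real (card (W k)))) - 2)
     \<le> \<theta> * (\<Sum>z\<in>UNIV. P z * (\<Sum>k<K. ln (real (card (W' z k)))))"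
    using \<theta> by (intro mult_left_mono) auto
  moreover have "(\<Sum>z\<in>UNIV. P z * \<Phi> (W' z)) = (\<Sum>z\<in>UNIV. P z * index_sum E \<gamma> K (W' z))
     + \<theta> * (\<Sum>z\<in>UNIV. P z * (\<Sum>k<K. ln (real (card (W' z k)))))"
    by (simp add: \<Phi> distrib_left sum.distrib sum_distrib_left mult_ac)
  ultimately show ?thesis using 1 by (simp add: \<Phi> P_def gap_def algebra_simps)
qed

text \<open>Regularity is one-sided, since embedding cliques needs only lower bounds on densities
  between large subsets.\<close>

definition regular_family :: "real \<Rightarrow> real \<Rightarrow> 'a set set \<Rightarrow> nat \<Rightarrow> (nat \<Rightarrow> 'a set) \<Rightarrow> bool" where
  "regular_family \<sigma> \<eta> E K W \<longleftrightarrow> (\<forall>i<K. \<forall>j<K. i \<noteq> j \<longrightarrow> (\<forall>A B. A \<subseteq> W i \<longrightarrow> B \<subseteq> W j \<longrightarrow>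
     \<sigma> * real (card (W i)) \<le> real (card A) \<longrightarrow> \<sigma> * real (card (W j)) \<le> real (card B) \<longrightarrow>
     edge_density E (W i) (W j) - \<eta> \<le> edge_density E A B))"

text \<open>The tuple is a maximiser of \<open>\<Phi>\<close>. Comparing it with the constant tuple
  \<open>V, ..., V\<close> gives both the density bound and the size bound, and comparing it with
  its splits gives regularity. The constant \<open>c\<close> is fixed before the graph.\<close>

lemma regular_tuple:
  fixes K :: nat and \<gamma> \<eta> \<sigma> :: real
  assumes "\<gamma> > 0" "\<eta> > 0" "\<sigma> > 0"
  shows "\<exists>c>0. \<forall>V (E :: 'a set set). finite V \<longrightarrow> V \<noteq> {} \<longrightarrow> (\<exists>W.
    (\<forall>k<K. W k \<subseteq> V \<and> c * real (card V) \<le> real (card (W k))) \<and>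
    real K * (real K - 1) * (edge_density E V V - \<gamma>) \<le> (\<Sum>k<K. \<Sum>l\<in>{..<K}-{k}. edge_density E (W k) (W l)) \<and>
    regular_family \<sigma> \<eta> E K W)"
proof -
  \<comment> \<open>An irregular pair gains at least
    \<open>\<gamma> * (\<sigma> * \<sigma> * \<eta>\<^sup>2)\<close> in the quadratic part; this
    choice makes the logarithmic loss \<open>2 * \<theta>\<close> only half of that.\<close>
  define \<theta> where "\<theta> = \<gamma> * (\<sigma> * \<sigma> * \<eta>\<^sup>2) / 4"
  have \<theta>: "\<theta> > 0" using assms by (simp add: \<theta>_def)
  \<comment> \<open>\<open>M\<close> is an upper bound for the index sum of any tuple, hence for
    \<open>\<theta>\<close> times the total logarithmic shrinkage of the maximiser. This dictates
    \<open>c = exp (- (M / \<theta>))\<close>.\<close>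
  define M where "M = real K * (real K - 1) * (1 + \<gamma>)"
  define c where "c = exp (- (M / \<theta>))"
  have pairs: "(\<Sum>k<K. \<Sum>l\<in>{..<K}-{k}. x) = real K * (real K - 1) * x" for x :: real
    by (cases K) (auto simp: of_nat_diff)
  show ?thesis
  proof (intro exI[of _ c] conjI allI impI)
    show "c > 0" by (simp add: c_def)
    fix V :: "'a set" and E :: "'a set set"
    assume V: "finite V" "V \<noteq> {}"
    \<comment> \<open>Functions outside \<open>{..<K}\<close> are fixed by extensionality, so
      \<open>D\<close> is finite and a maximiser exists.\<close>
    define D where "D = PiE {..<K} (\<lambda>_. Pow V - {{}})"
    define \<Phi> where "\<Phi> = (\<lambda>W. index_sum E \<gamma> K W + \<theta> * (\<Sum>k<K. ln (real (card (W k)))))"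
    define W0 where "W0 = restrict (\<lambda>_. V) {..<K}"
    have W0: "W0 \<in> D" using V by (auto simp: D_def W0_def)
    have finD: "finite (\<Phi> ` D)" unfolding D_def using finite_PiE_nonempty_subsets[OF V(1)] by simp
    obtain W where W: "W \<in> D" "\<And>X. X \<in> D \<Longrightarrow> \<Phi> X \<le> \<Phi> W"
    proof -
      have "Max (\<Phi> ` D) \<in> \<Phi> ` D" using finD W0 by (intro Max_in) auto
      then obtain W where "W \<in> D" "\<Phi> W = Max (\<Phi> ` D)" by auto
      then show ?thesis using that finD by (metis Max_ge imageI)
    qed
    have Wk: "W k \<subseteq> V" "W k \<noteq> {}" "finite (W k)" if "k < K" for k
      using W(1) that V(1) unfolding D_def by (auto dest!: PiE_mem[where x = k] intro: finite_subset)
    have ln_le: "ln (real (card (W k))) \<le> ln (real (card V))" if "k < K" for k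
      using Wk[OF that] V by (simp add: card_mono card_gt_0_iff)
    let ?S = "\<Sum>k<K. \<Sum>l\<in>{..<K}-{k}. edge_density E (W k) (W l)"
    have sq: "(edge_density E A B)\<^sup>2 \<le> 1" for A B
      using edge_density_nonneg[of E A B] edge_density_le_1[of E A B] by (simp add: power_le_one)
    have idx_le: "index_sum E \<gamma> K W \<le> ?S + real K * (real K - 1) * \<gamma>"
    proof -
      have "index_sum E \<gamma> K W \<le> (\<Sum>k<K. \<Sum>l\<in>{..<K}-{k}. edge_density E (W k) (W l) + \<gamma>)"
        unfolding index_sum_def using sq assms(1) by (intro sum_mono) auto
      then show ?thesis by (simp only: sum.distrib pairs)
    qed
    have S_le: "?S \<le> real K * (real K - 1)"
    proof -
      have "?S \<le> (\<Sum>k<K. \<Sum>l\<in>{..<K}-{k}. 1)"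
        using edge_density_le_1 by (intro sum_mono) auto
      then show ?thesis by (simp only: pairs)
    qed
    have idx_ge: "index_sum E \<gamma> K W0 \<ge> real K * (real K - 1) * edge_density E V V"
    proof -
      have "(\<Sum>k<K. \<Sum>l\<in>{..<K}-{k}. edge_density E V V) \<le> index_sum E \<gamma> K W0"
        unfolding index_sum_def W0_def using assms(1) by (intro sum_mono) auto
      then show ?thesis by (simp only: pairs)
    qed
    have lnW0: "(\<Sum>k<K. ln (real (card (W0 k)))) = (\<Sum>k<K. ln (real (card V)))"
      by (intro sum.cong) (auto simp: W0_def)
    have main: "index_sum E \<gamma> K W0 + \<theta> * (\<Sum>k<K. ln (real (card V)) - ln (real (card (W k)))) \<le> index_sum E \<gamma> K W"
      using W(2)[OF W0] by (simp add: \<Phi>_def lnW0 sum_subtractf right_diff_distrib)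
    have KK: "real K * (real K - 1) \<ge> 0" by (cases K) auto
    have size: "c * real (card V) \<le> real (card (W k))" if "k < K" for k
    proof -
      have "ln (real (card V)) - ln (real (card (W k))) \<le> (\<Sum>k<K. ln (real (card V)) - ln (real (card (W k))))"
        using that ln_le by (intro member_le_sum) auto
      then have "\<theta> * (ln (real (card V)) - ln (real (card (W k))))
          \<le> \<theta> * (\<Sum>k<K. ln (real (card V)) - ln (real (card (W k))))"
        using \<theta> by (intro mult_left_mono) auto
      also have "\<dots> \<le> M"
      proof -
        have "0 \<le> real K * (real K - 1) * edge_density E V V"
          by (rule mult_nonneg_nonneg[OF KK edge_density_nonneg])
        then show ?thesis using main idx_le idx_ge S_le by (simp add: M_def distrib_left)
      qed
      finally have "ln (real (card V)) - M / \<theta> \<le> ln (real (card (W k)))"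
        using \<theta> by (simp add: field_simps)
      then have "exp (ln (real (card V)) - M / \<theta>) \<le> exp (ln (real (card (W k))))" by simp
      moreover have "real (card V) > 0" "real (card (W k)) > 0"
        using V Wk[OF that] by (simp_all add: card_gt_0_iff)
      ultimately show ?thesis by (simp add: c_def exp_diff exp_minus field_simps)
    qed
    have "\<theta> * (\<Sum>k<K. ln (real (card V)) - ln (real (card (W k)))) \<ge> 0"
      using \<theta> ln_le by (intro mult_nonneg_nonneg sum_nonneg) auto
    then have dens: "real K * (real K - 1) * (edge_density E V V - \<gamma>) \<le> ?S"
      using main idx_le idx_ge by (simp add: right_diff_distrib)
    have reg: "edge_density E (W i) (W j) - \<eta> \<le> edge_density E A B"
      if ij: "i < K" "j < K" "i \<noteq> j" and AB: "A \<subseteq> W i" "B \<subseteq> W j"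
        and big: "\<sigma> * real (card (W i)) \<le> real (card A)" "\<sigma> * real (card (W j)) \<le> real (card B)" for i j A B
    proof (rule ccontr)
      assume "\<not> ?thesis"
      then have dev: "edge_density E (W i) (W j) - edge_density E A B > \<eta>" by simp
      define a where "a = (\<lambda>x. if x then A else W i - A)"
      define b where "b = (\<lambda>y. if y then B else W j - B)"
      define \<alpha> where "\<alpha> = (\<lambda>x. real (card (a x)) / real (card (W i)))"
      define \<beta> where "\<beta> = (\<lambda>y. real (card (b y)) / real (card (W j)))"
      define W' where "W' = (\<lambda>z. W(i := a (fst z), j := b (snd z)))"
      have sub: "a x \<subseteq> V" "b y \<subseteq> V" for x y
        using AB Wk[OF ij(1)] Wk[OF ij(2)] by (auto simp: a_def b_def)
      \<comment> \<open>A split with an empty part leaves \<open>D\<close>, where maximality says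
        nothing, but such an outcome has weight 0.\<close>
      have le: "\<alpha> (fst z) * \<beta> (snd z) * \<Phi> (W' z) \<le> \<alpha> (fst z) * \<beta> (snd z) * \<Phi> W" for z
      proof (cases "a (fst z) = {} \<or> b (snd z) = {}")
        case True
        then show ?thesis by (auto simp: \<alpha>_def \<beta>_def)
      next
        case False
        have "W' z \<in> D"
          using W(1) False sub ij unfolding D_def W'_def by (auto simp: PiE_iff extensional_def)
        then have "\<Phi> (W' z) \<le> \<Phi> W" by (rule W(2))
        then show ?thesis by (intro mult_left_mono) (auto simp: \<alpha>_def \<beta>_def)
      qed
      have "(\<Sum>z\<in>UNIV. \<alpha> (fst z) * \<beta> (snd z) * \<Phi> (W' z)) \<le> (\<Sum>z\<in>UNIV. \<alpha> (fst z) * \<beta> (snd z) * \<Phi> W)"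
        using le by (intro sum_mono) auto
      also have "\<dots> = (\<alpha> True + \<alpha> False) * (\<beta> True + \<beta> False) * \<Phi> W"
        by (simp add: sum_bool_pair algebra_simps)
      also have "\<dots> = \<Phi> W"
        using weights_split[of "W i" A] weights_split[of "W j" B] Wk[OF ij(1)] Wk[OF ij(2)] AB
        by (simp add: \<alpha>_def \<beta>_def a_def b_def)
      finally have "\<gamma> * (\<alpha> True * \<beta> True * (edge_density E A B - edge_density E (W i) (W j))\<^sup>2) \<le> 2 * \<theta>"
        using mean_index_split[OF ij _ AB _ _ a_def b_def \<alpha>_def \<beta>_def W'_def \<Phi>_def] Wk assms(1) \<theta>
        by force
      moreover have "\<gamma> * (\<sigma> * \<sigma> * \<eta>\<^sup>2) \<le> \<gamma> * (\<alpha> True * \<beta> True * (edge_density E A B - edge_density E (W i) (W j))\<^sup>2)"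
      proof -
        have "\<sigma> \<le> \<alpha> True" "\<sigma> \<le> \<beta> True"
          using big Wk[OF ij(1)] Wk[OF ij(2)]
          by (simp_all add: \<alpha>_def \<beta>_def a_def b_def pos_le_divide_eq card_gt_0_iff)
        moreover have "\<eta>\<^sup>2 \<le> (edge_density E A B - edge_density E (W i) (W j))\<^sup>2"
          using dev assms(2) by (metis abs_ge_self abs_le_square_iff abs_minus_commute abs_of_pos less_eq_real_def order_trans)
        ultimately show ?thesis using assms by (intro mult_left_mono mult_mono) auto
      qed
      ultimately show False using \<theta> by (simp add: \<theta>_def)
    qed
    show "\<exists>W. (\<forall>k<K. W k \<subseteq> V \<and> c * real (card V) \<le> real (card (W k))) \<and>
      real K * (real K - 1) * (edge_density E V V - \<gamma>) \<le> (\<Sum>k<K. \<Sum>l\<in>{..<K}-{k}. edge_density E (W k) (W l)) \<and>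
      regular_family \<sigma> \<eta> E K W"
      using Wk(1) size dens reg unfolding regular_family_def by (intro exI[of _ W] conjI allI impI) auto
  qed
qed

section \<open>Large cliques from dense regular pairs\<close>

section \<open>Embedding cliques\<close>

lemma ecount_as_sum_degrees: "ecount E A X = (\<Sum>v\<in>A. ecount E {v} X)"
  by (simp add: ecount_def)

lemma ecount_singleton: "finite X \<Longrightarrow> ecount E {v} X = real (card {u \<in> X. {v, u} \<in> E})"
  by (simp add: ecount_def Int_def)

text \<open>If there were \<open>m\<close> such vertices, they would themselves form a set
  \<open>A\<close> sending too few edges to \<open>X\<close>.\<close>

lemma few_low_degree:
  assumes "finite U" "m > 0"
    and "\<And>A. A \<subseteq> U \<Longrightarrow> m \<le> real (card A) \<Longrightarrow> d * real (card A) * real (card X) \<le> ecount E A X"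
  shows "real (card {v \<in> U. ecount E {v} X < d * real (card X)}) < m"
proof (rule ccontr)
  let ?B = "{v \<in> U. ecount E {v} X < d * real (card X)}"
  assume "\<not> ?thesis"
  then have big: "m \<le> real (card ?B)" by simp
  then have "card ?B \<noteq> 0" using assms(2) by (metis not_less of_nat_0)
  then have ne: "finite ?B" "?B \<noteq> {}" unfolding card_eq_0_iff by blast+
  have "ecount E ?B X < (\<Sum>v\<in>?B. d * real (card X))"
    unfolding ecount_as_sum_degrees[of E ?B] by (intro sum_strict_mono ne) auto
  also have "\<dots> = d * real (card ?B) * real (card X)" by simp
  finally show False using assms(3)[of ?B] big by auto
qed

text \<open>Double counting the pairs between \<open>Q\<close> and \<open>Y\<close>: a vertex of
  \<open>Y\<close> contributes at most \<open>w - 1\<close> unless it lies in \<open>Z\<close>,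
  where it contributes at most \<open>p\<close>. Hence \<open>Z\<close> has at least
  \<open>\<eta> * card Y\<close> vertices. Each of them is joined to a whole \<open>w\<close>-subset
  of \<open>Q\<close>, and there are at most \<open>2 ^ p\<close> such subsets.\<close>

lemma popular_subset:
  fixes w p :: nat
  assumes Q: "finite Q" "card Q = p" "p > 0" and Y: "finite Y" "Y \<noteq> {}" and \<eta>: "\<eta> > 0" and w: "w > 0"
    and deg: "\<And>v. v \<in> Q \<Longrightarrow> ((real w - 1) / real p + \<eta>) * real (card Y) \<le> ecount E {v} Y"
  shows "\<exists>T\<subseteq>Q. card T = w \<and> \<eta> * real (card Y) \<le> 2 ^ p * real (card {u \<in> Y. \<forall>v\<in>T. {v, u} \<in> E})"
proof -
  define cnt where "cnt u = card {v \<in> Q. {v, u} \<in> E}" for u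
  define Z where "Z = {u \<in> Y. w \<le> cnt u}"
  define N where "N T = {u \<in> Y. \<forall>v\<in>T. {v, u} \<in> E}" for T
  define F where "F = {T. T \<subseteq> Q \<and> card T = w}"
  have finF: "finite F" "F \<subseteq> Pow Q" using Q(1) by (auto simp: F_def)
  have cntp: "cnt u \<le> p" for u
    unfolding cnt_def Q(2)[symmetric] by (intro card_mono Q(1)) auto
  have "(real w - 1 + real p * \<eta>) * real (card Y) = (\<Sum>v\<in>Q. ((real w - 1) / real p + \<eta>) * real (card Y))"
    using Q by (simp add: field_simps)
  also have "\<dots> \<le> (\<Sum>v\<in>Q. ecount E {v} Y)" using deg by (intro sum_mono)
  also have "\<dots> = (\<Sum>u\<in>Y. \<Sum>v\<in>Q. of_bool ({v, u} \<in> E))"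
    unfolding ecount_def by (simp add: sum.swap[of _ Q])
  also have "\<dots> = (\<Sum>u\<in>Y. real (cnt u))"
    using Q(1) by (simp add: cnt_def Int_def)
  also have "\<dots> \<le> (\<Sum>u\<in>Y. (real w - 1) + (if u \<in> Z then real p else 0))"
  proof (rule sum_mono)
    fix u assume u: "u \<in> Y"
    show "real (cnt u) \<le> (real w - 1) + (if u \<in> Z then real p else 0)"
    proof (cases "w \<le> cnt u")
      case True
      then show ?thesis using cntp[of u] u w by (simp add: Z_def)
    qed (use u in \<open>auto simp: Z_def\<close>)
  qed
  also have "\<dots> = (real w - 1) * real (card Y) + real p * real (card Z)"
    using Y(1) by (simp add: sum.distrib sum.If_cases Z_def Int_def)
  finally have "real p * (\<eta> * real (card Y)) \<le> real p * real (card Z)"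
    by (simp add: algebra_simps)
  then have Zbig: "\<eta> * real (card Y) \<le> real (card Z)" using Q(3) by simp
  have cY: "real (card Y) > 0" using Y by (simp add: card_gt_0_iff)
  have ZN: "Z \<subseteq> (\<Union>T\<in>F. N T)"
  proof
    fix u assume u: "u \<in> Z"
    then obtain T where "T \<subseteq> {v \<in> Q. {v, u} \<in> E}" "card T = w"
      using obtain_subset_with_card_n[of w "{v \<in> Q. {v, u} \<in> E}"] by (auto simp: Z_def cnt_def)
    then show "u \<in> (\<Union>T\<in>F. N T)" using u by (auto simp: F_def N_def Z_def)
  qed
  have Fne: "F \<noteq> {}"
  proof
    assume "F = {}"
    then have "Z = {}" using ZN by simp
    then show False using Zbig cY \<eta> by (simp add: mult_le_0_iff)
  qed
  have "\<exists>T\<in>F. \<eta> * real (card Y) \<le> 2 ^ p * real (card (N T))"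
  proof (rule ccontr)
    assume "\<not> ?thesis"
    then have less: "real (card (N T)) < \<eta> * real (card Y) / 2 ^ p" if "T \<in> F" for T
      using that by (force simp: field_simps)
    have "real (card Z) \<le> real (card (\<Union>T\<in>F. N T))"
      using ZN Y(1) finF(1) by (intro of_nat_mono card_mono) (auto simp: N_def)
    also have "\<dots> \<le> real (\<Sum>T\<in>F. card (N T))"
      by (intro of_nat_mono card_UN_le finF)
    also have "\<dots> < (\<Sum>T\<in>F. \<eta> * real (card Y) / 2 ^ p)"
      unfolding of_nat_sum using less finF Fne by (intro sum_strict_mono) auto
    also have "\<dots> = real (card F) * (\<eta> * real (card Y) / 2 ^ p)" by simp
    also have "\<dots> \<le> real (2 ^ p) * (\<eta> * real (card Y) / 2 ^ p)"
    proof (intro mult_right_mono of_nat_mono)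
      show "card F \<le> 2 ^ p" using card_mono[OF _ finF(2)] Q by (simp add: card_Pow)
    qed (use \<eta> in auto)
    also have "\<dots> = \<eta> * real (card Y)" by simp
    finally show False using Zbig by simp
  qed
  then show ?thesis unfolding F_def N_def by blast
qed


text \<open>The positive form of having \<open>alpha\<close> at most \<open>a\<close>. For
  \<open>p > 0\<close> the condition \<open>card Q = p\<close> already makes \<open>Q\<close>
  finite.\<close>

definition rich :: "nat \<Rightarrow> real \<Rightarrow> 'a set \<Rightarrow> 'a set set \<Rightarrow> bool" where
  "rich p a V E \<longleftrightarrow> (\<forall>X\<subseteq>V. a < real (card X) \<longrightarrow> (\<exists>Q\<subseteq>X. card Q = p \<and> clique Q E))"

text \<open>After deletion of the vertices with low degree into \<open>U'\<close>, the set
  \<open>U\<close> still contains a \<open>p\<close>-clique \<open>Q\<close>. By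
  \<open>popular_subset\<close>, some \<open>w\<close> vertices of \<open>Q\<close> have a common
  neighbourhood in \<open>U'\<close> of more than \<open>a\<close> vertices, which contains a second
  \<open>p\<close>-clique. The \<open>w\<close> vertices and this clique together form the
  result.\<close>

lemma clique_in_pair:
  fixes w p :: nat
  assumes U: "finite U" "finite U'" "U \<subseteq> V" "U' \<subseteq> V" and p: "p > 0" and w: "w > 0"
    and loops: "\<And>v. {v} \<notin> E" and \<eta>: "0 < \<eta>" "\<eta> \<le> 1" and rich: "rich p a V E"
    and a: "a \<ge> 0" "a < m" "2 ^ p * a < \<eta> * real (card U')"
    and big: "2 * m \<le> real (card U)"
    and low: "\<And>A. A \<subseteq> U \<Longrightarrow> m \<le> real (card A) \<Longrightarrow>
      ((real w - 1) / real p + \<eta>) * real (card A) * real (card U') \<le> ecount E A U'"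
  shows "\<exists>C\<subseteq>U \<union> U'. finite C \<and> card C = p + w \<and> clique C E"
proof -
  let ?d = "(real w - 1) / real p + \<eta>"
  define B where "B = {v \<in> U. ecount E {v} U' < ?d * real (card U')}"
  have "real (card B) < m"
    unfolding B_def using a(1,2) low by (intro few_low_degree U) auto
  moreover have "real (card (U - B)) = real (card U) - real (card B)"
    using U(1) by (subst card_Diff_subset) (auto simp: B_def card_mono of_nat_diff)
  ultimately have "a < real (card (U - B))" using a(2) big by linarith
  then obtain Q where Q: "Q \<subseteq> U - B" "card Q = p" "clique Q E"
    using rich U(3) unfolding rich_def by (meson Diff_subset order_trans)
  have "0 \<le> 2 ^ p * a" using a(1) by simp
  then have "U' \<noteq> {}" using a(3) by (metis card.empty of_nat_0 mult_zero_right not_less)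
  moreover have "finite Q" using Q(2) p by (simp add: card_ge_0_finite)
  ultimately obtain T where T: "T \<subseteq> Q" "card T = w"
    "\<eta> * real (card U') \<le> 2 ^ p * real (card {u \<in> U'. \<forall>v\<in>T. {v, u} \<in> E})"
    using popular_subset[of Q p U' \<eta> w E] Q p w U \<eta> by (force simp: B_def)
  define N where "N = {u \<in> U'. \<forall>v\<in>T. {v, u} \<in> E}"
  have "2 ^ p * a < 2 ^ p * real (card N)" using T(3) a(3) unfolding N_def by linarith
  then have "a < real (card N)" by simp
  moreover have "N \<subseteq> V" using U(4) by (auto simp: N_def)
  ultimately obtain Q' where Q': "Q' \<subseteq> N" "card Q' = p" "clique Q' E"
    using rich unfolding rich_def by meson
  \<comment> \<open>\<open>U\<close> and \<open>U'\<close> may overlap, but a common vertex of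
    \<open>T\<close> and \<open>Q'\<close> would be adjacent to itself.\<close>
  have disj: "T \<inter> Q' = {}" using Q'(1) loops by (force simp: N_def)
  have fin: "finite T" "finite Q'" using T w Q' p by (auto intro: card_ge_0_finite)
  show ?thesis
  proof (intro exI[of _ "T \<union> Q'"] conjI)
    show "T \<union> Q' \<subseteq> U \<union> U'" using T Q Q' by (auto simp: N_def)
    show "card (T \<union> Q') = p + w" using card_Un_disjoint[OF fin disj] T Q' by simp
    show "clique (T \<union> Q') E"
      using Q'(1) by (intro clique_Un smaller_clique[OF Q(3) T(1)] Q'(3)) (auto simp: N_def)
  qed (use fin in auto)
qed

text \<open>Induction on \<open>S\<close>: a typical vertex of \<open>U k\<close> is chosen and all
  other sets shrink to its neighbourhood, losing a factor \<open>\<eta>\<close> each time, which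
  \<open>\<eta> ^ card S\<close> pays for. The thresholds \<open>\<mu>\<close> are absolute, so the
  density hypotheses pass to subsets unchanged. The last two sets are left to
  \<open>clique_in_pair\<close>.\<close>

lemma clique_in_tuple:
  fixes w p :: nat and \<mu> :: "'i \<Rightarrow> real" and U :: "'i \<Rightarrow> 'a set"
  assumes "finite S" "i \<notin> S" "j \<notin> S" "i \<noteq> j"
    and p: "p > 0" and w: "w > 0"
    and loops: "\<And>v. {v} \<notin> E" and \<eta>: "0 < \<eta>" "\<eta> \<le> 1" and rich: "rich p a V E"
    and a: "a \<ge> 0" "\<And>k. 2 ^ p * a < \<eta> * \<mu> k"
    and R: "real (card S) + 2 \<le> R"
    and U: "\<And>k. k \<in> insert i (insert j S) \<Longrightarrow> finite (U k) \<and> U k \<subseteq> V"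
    and big: "\<And>k. k \<in> insert i (insert j S) \<Longrightarrow> R * \<mu> k \<le> \<eta> ^ card S * real (card (U k))"
    and low: "\<And>k l A B. k \<in> insert i (insert j S) \<Longrightarrow> l \<in> insert i (insert j S) \<Longrightarrow> k \<noteq> l \<Longrightarrow>
      A \<subseteq> U k \<Longrightarrow> B \<subseteq> U l \<Longrightarrow> \<mu> k \<le> real (card A) \<Longrightarrow> \<mu> l \<le> real (card B) \<Longrightarrow>
      \<eta> * real (card A) * real (card B) \<le> ecount E A B"
    and low_ij: "\<And>A B. A \<subseteq> U i \<Longrightarrow> B \<subseteq> U j \<Longrightarrow> \<mu> i \<le> real (card A) \<Longrightarrow> \<mu> j \<le> real (card B) \<Longrightarrow>
      ((real w - 1) / real p + \<eta>) * real (card A) * real (card B) \<le> ecount E A B"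
  shows "\<exists>C\<subseteq>(\<Union>k\<in>insert i (insert j S). U k). finite C \<and> card C = p + w + card S \<and> clique C E"
  using assms(1-3) R U big low low_ij
proof (induction S arbitrary: U rule: finite_induct)
  case empty
  have \<mu>: "a < \<mu> k" "0 < \<mu> k" for k
  proof -
    have "1 * a \<le> 2 ^ p * a" using a(1) by (intro mult_right_mono) auto
    also have "\<dots> < \<eta> * \<mu> k" by (rule a(2))
    finally have *: "a < \<eta> * \<mu> k" by simp
    then show "0 < \<mu> k" using a(1) \<eta> by (meson le_less_trans zero_less_mult_pos)
    then have "\<eta> * \<mu> k \<le> 1 * \<mu> k" using \<eta> by (intro mult_right_mono) auto
    then show "a < \<mu> k" using * by simp
  qed
  have ge: "2 * \<mu> k \<le> real (card (U k))" if "k \<in> {i, j}" for k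
  proof -
    have "2 * \<mu> k \<le> R * \<mu> k" using empty.prems(3) \<mu>(2)[of k] by (intro mult_right_mono) auto
    also have "\<dots> \<le> real (card (U k))" using empty.prems(5)[of k] that by simp
    finally show ?thesis .
  qed
  have j: "\<mu> j \<le> real (card (U j))" using ge[of j] \<mu>(2)[of j] by simp
  have "\<exists>C\<subseteq>U i \<union> U j. finite C \<and> card C = p + w \<and> clique C E"
  proof (rule clique_in_pair[OF _ _ _ _ p w loops \<eta> rich a(1), where m = "\<mu> i"])
    have "\<eta> * \<mu> j \<le> \<eta> * real (card (U j))" using j \<eta> by (intro mult_left_mono) auto
    then show "2 ^ p * a < \<eta> * real (card (U j))" using a(2)[of j] by linarith
  qed (use empty.prems ge \<mu> j in auto)
  then show ?case by simp
next
  case (insert k S)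
  let ?I = "insert i (insert j S)"
  have ki: "k \<noteq> i" "k \<noteq> j" "k \<notin> ?I" using insert.hyps insert.prems by auto
  have \<mu>: "0 < \<mu> l" for l
    using a \<eta> by (metis less_eq_real_def mult_nonneg_nonneg not_less order_le_less_trans zero_le_numeral zero_le_power zero_less_mult_pos)
  have R1: "1 \<le> R" using insert.prems(3) by simp
  have ge: "R * \<mu> l \<le> real (card (U l))" if "l \<in> insert i (insert j (insert k S))" for l
  proof -
    have "\<eta> ^ card (insert k S) * real (card (U l)) \<le> 1 * real (card (U l))"
      using \<eta> by (intro mult_right_mono power_le_one) auto
    then show ?thesis using insert.prems(5)[OF that] by simp
  qed
  have ge1: "\<mu> l \<le> real (card (U l))" if "l \<in> insert i (insert j (insert k S))" for l
  proof -
    have "1 * \<mu> l \<le> R * \<mu> l" using R1 \<mu>[of l] by (intro mult_right_mono) auto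
    then show ?thesis using ge[OF that] by simp
  qed
  define B where "B l = {v \<in> U k. ecount E {v} (U l) < \<eta> * real (card (U l))}" for l
  have Bs: "real (card (B l)) < \<mu> k" if "l \<in> ?I" for l
    unfolding B_def
  proof (rule few_low_degree)
    fix A assume "A \<subseteq> U k" "\<mu> k \<le> real (card A)"
    then show "\<eta> * real (card A) * real (card (U l)) \<le> ecount E A (U l)"
      using insert.prems(6)[of k l A "U l"] that ki ge1 by auto
  qed (use insert.prems(4) \<mu> in auto)
  \<comment> \<open>The \<open>card S + 2\<close> remaining sets each exclude fewer than
    \<open>\<mu> k\<close> vertices of \<open>U k\<close>; the factor \<open>R\<close> leaves room
    for all of them.\<close>
  have "real (card (\<Union>l\<in>?I. B l)) \<le> (\<Sum>l\<in>?I. real (card (B l)))"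
    using card_UN_le[of ?I B] insert.hyps by (metis finite_insert of_nat_le_iff of_nat_sum)
  also have "\<dots> < (\<Sum>l\<in>?I. \<mu> k)"
    using Bs insert.hyps by (intro sum_strict_mono) auto
  also have "\<dots> = (real (card S) + 2) * \<mu> k"
    using insert.hyps insert.prems assms(4) by simp
  also have "\<dots> \<le> R * \<mu> k"
    using insert.prems(3) \<mu>[of k] insert.hyps by (intro mult_right_mono) auto
  also have "\<dots> \<le> real (card (U k))" using ge by simp
  finally have "card (\<Union>l\<in>?I. B l) < card (U k)" by simp
  then have "\<not> U k \<subseteq> (\<Union>l\<in>?I. B l)"
    using insert.prems(4) insert.hyps
    by (metis (no_types, lifting) B_def card_mono finite_UN finite_insert finite_Collect_conjI insertCI leD mem_Collect_eq finite_subset subsetI)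
  then obtain v where v: "v \<in> U k" "\<And>l. l \<in> ?I \<Longrightarrow> v \<notin> B l" by blast
  define U' where "U' l = {u \<in> U l. {v, u} \<in> E}" for l
  have U': "U' l \<subseteq> U l" for l by (auto simp: U'_def)
  have "\<exists>C\<subseteq>(\<Union>l\<in>?I. U' l). finite C \<and> card C = p + w + card S \<and> clique C E"
  proof (rule insert.IH)
    show "real (card S) + 2 \<le> R" using insert.prems(3) insert.hyps by simp
    show "finite (U' l) \<and> U' l \<subseteq> V" if "l \<in> ?I" for l
      using insert.prems(4)[of l] that U'[of l] finite_subset by blast
    show "R * \<mu> l \<le> \<eta> ^ card S * real (card (U' l))" if l: "l \<in> ?I" for l
    proof -
      have "\<eta> * real (card (U l)) \<le> real (card (U' l))"
        using v(2)[OF l] v(1) insert.prems(4)[of l] l ecount_singleton[of "U l" E v]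
        by (auto simp: B_def U'_def)
      then have "\<eta> ^ card S * (\<eta> * real (card (U l))) \<le> \<eta> ^ card S * real (card (U' l))"
        using \<eta> by (intro mult_left_mono) auto
      moreover have "R * \<mu> l \<le> \<eta> ^ card (insert k S) * real (card (U l))"
        using l by (intro insert.prems(5)) auto
      ultimately show ?thesis using insert.hyps by (simp add: mult_ac)
    qed
    show "\<eta> * real (card A) * real (card B) \<le> ecount E A B"
      if "l \<in> ?I" "l' \<in> ?I" "l \<noteq> l'" "A \<subseteq> U' l" "B \<subseteq> U' l'" "\<mu> l \<le> real (card A)" "\<mu> l' \<le> real (card B)"
      for l l' A B
      using that U' by (intro insert.prems(6)[of l l']) blast+
    show "((real w - 1) / real p + \<eta>) * real (card A) * real (card B) \<le> ecount E A B"
      if "A \<subseteq> U' i" "B \<subseteq> U' j" "\<mu> i \<le> real (card A)" "\<mu> j \<le> real (card B)" for A B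
      using that U' by (intro insert.prems(7)) blast+
  qed (use insert.prems in auto)
  then obtain C where C: "C \<subseteq> (\<Union>l\<in>?I. U' l)" "finite C" "card C = p + w + card S" "clique C E"
    by blast
  have vC: "{v, u} \<in> E" if "u \<in> C" for u using C(1) that by (auto simp: U'_def)
  \<comment> \<open>The sets need not be disjoint, so that \<open>v\<close> is new follows from the
    absence of loops.\<close>
  then have "v \<notin> C" using loops[of v] by force
  show ?case
  proof (intro exI[of _ "insert v C"] conjI)
    show "insert v C \<subseteq> (\<Union>l\<in>insert i (insert j (insert k S)). U l)"
      using C(1) v(1) U' by blast
    show "card (insert v C) = p + w + card (insert k S)"
      using C \<open>v \<notin> C\<close> insert.hyps by simp
    show "clique (insert v C) E"
      using C(4) vC unfolding clique_def by (metis insert_commute insert_iff)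
  qed (use C in auto)
qed

section \<open>From regular tuples to a bound on the number of edges\<close>

lemma ecount_ge_of_density:
  assumes "x \<le> edge_density E A B"
  shows "x * real (card A) * real (card B) \<le> ecount E A B"
proof (cases "card A = 0 \<or> card B = 0")
  case False
  then show ?thesis using assms by (simp add: edge_density_def field_simps)
qed (auto simp: ecount_nonneg)

text \<open>Each density, lowered by \<open>2 * \<eta>\<close>, is rounded up to a multiple of
  \<open>1 / p\<close>. Embedding limits these weights on every clique of indices, and
  \<open>weighted_turan\<close> bounds their sum. The errors are \<open>\<delta> / 4\<close> from
  passing to the tuple, \<open>2 * \<eta> \<le> \<delta> / 4\<close> from lowering the densities,
  and \<open>\<delta> / 2\<close> from the missing diagonal.\<close>

lemma edges_bound:
  fixes p s t :: nat and \<delta> :: real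
  assumes p: "p > 0" and t: "t > 0" and st: "int t * (int t - 2) \<le> int s" "s \<le> t\<^sup>2"
    and \<delta>: "\<delta> > 0"
  shows "\<exists>\<epsilon>>0. \<forall>n E. sgraph {..<n} E \<longrightarrow> K_free (p + s + t - 1) {..<n} E \<longrightarrow>
    rich p (\<epsilon> * real n) {..<n::nat} E \<longrightarrow>
    2 * real (card E) \<le> (real s / real p * (1 - 1 / real t) + \<delta>) * (real n)\<^sup>2"
proof -
  define b' where "b' = real s * (1 - 1 / real t)"
  define b where "b = real s / real p * (1 - 1 / real t)"
  have b0: "b' \<ge> 0" "b \<ge> 0" using t by (auto simp: b_def b'_def)
  \<comment> \<open>Only \<open>K * (K - 1)\<close> ordered pairs are available against a bound of
    order \<open>K^2\<close>; for this \<open>K\<close> one has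
    \<open>b * K \<le> (K - 1) * (b + \<delta> / 2)\<close>.\<close>
  define K where "K = nat \<lceil>2 * b / \<delta>\<rceil> + 2"
  have K: "2 * b / \<delta> \<le> real K - 1" "K \<ge> 2"
    unfolding K_def using real_nat_ceiling_ge[of "2 * b / \<delta>"] by auto
  define \<eta> where "\<eta> = min 1 (\<delta> / 8)"
  have \<eta>: "0 < \<eta>" "\<eta> \<le> 1" "\<eta> \<le> \<delta> / 8" using \<delta> by (auto simp: \<eta>_def)
  \<comment> \<open>Chosen so that the size hypothesis of \<open>clique_in_tuple\<close> holds with
    \<open>R = K + 2\<close> and at most \<open>K\<close> shrinking steps.\<close>
  define \<sigma> where "\<sigma> = \<eta> ^ K / (real K + 2)"
  have \<sigma>: "\<sigma> > 0" using \<eta> by (simp add: \<sigma>_def)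
  obtain c where c: "c > 0" and tuple: "\<And>(V :: nat set) E. finite V \<Longrightarrow> V \<noteq> {} \<Longrightarrow> \<exists>W.
    (\<forall>k<K. W k \<subseteq> V \<and> c * real (card V) \<le> real (card (W k))) \<and>
    real K * (real K - 1) * (edge_density E V V - \<delta> / 4) \<le> (\<Sum>k<K. \<Sum>l\<in>{..<K}-{k}. edge_density E (W k) (W l)) \<and>
    regular_family \<sigma> \<eta> E K W"
    using regular_tuple[of "\<delta> / 4" \<eta> \<sigma> K] \<delta> \<eta> \<sigma> by auto
  \<comment> \<open>The exponent \<open>p + 1\<close> instead of \<open>p\<close> leaves a factor 2,
    which makes \<open>\<mu>_gt\<close> strict.\<close>
  define \<epsilon> where "\<epsilon> = \<eta> * \<sigma> * c / 2 ^ (p + 1)"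
  have \<epsilon>: "\<epsilon> > 0" using \<eta> \<sigma> c by (simp add: \<epsilon>_def)
  have "2 * real (card E) \<le> (b + \<delta>) * (real n)\<^sup>2"
    if G: "sgraph {..<n} E" and free: "K_free (p + s + t - 1) {..<n} E"
      and rich: "rich p (\<epsilon> * real n) {..<n} E" for n and E :: "nat set set"
  proof (cases "n = 0")
    case True
    then have "E = {}" using G by (auto simp: sgraph_def nsets_def)
    then show ?thesis using True by simp
  next
    case False
    then have n: "real n > 0" by simp
    have loops: "{v} \<notin> E" for v using G by (auto simp: sgraph_def nsets_def)
    obtain W where "\<forall>k<K. W k \<subseteq> {..<n} \<and> c * real (card {..<n}) \<le> real (card (W k))"
      and sum_W: "real K * (real K - 1) * (edge_density E {..<n} {..<n} - \<delta> / 4)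
        \<le> (\<Sum>k<K. \<Sum>l\<in>{..<K}-{k}. edge_density E (W k) (W l))"
      and "regular_family \<sigma> \<eta> E K W"
      using tuple[of "{..<n}" E] False by (auto simp only: finite_lessThan lessThan_empty_iff bot_nat_def)
    then have W: "\<And>k. k < K \<Longrightarrow> W k \<subseteq> {..<n} \<and> c * real n \<le> real (card (W k))"
      and reg: "\<And>i j A B. i < K \<Longrightarrow> j < K \<Longrightarrow> i \<noteq> j \<Longrightarrow> A \<subseteq> W i \<Longrightarrow> B \<subseteq> W j \<Longrightarrow>
        \<sigma> * real (card (W i)) \<le> real (card A) \<Longrightarrow> \<sigma> * real (card (W j)) \<le> real (card B) \<Longrightarrow>
        edge_density E (W i) (W j) - \<eta> \<le> edge_density E A B"
      unfolding regular_family_def by auto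
    \<comment> \<open>A positive weight \<open>w\<close> means density above
      \<open>(w - 1) / p + 2 * \<eta>\<close>: one \<open>\<eta>\<close> is lost to regularity and
      the other is the surplus that \<open>clique_in_tuple\<close> needs. The conversion
      \<open>nat\<close> sends negative values to weight 0.\<close>
    define w where "w k l = (if k = l then 0 else nat \<lceil>real p * (edge_density E (W k) (W l) - 2 * \<eta>)\<rceil>)" for k l
    have w_pos: "(real (w k l) - 1) / real p + 2 * \<eta> < edge_density E (W k) (W l)" if "w k l > 0" for k l
    proof -
      have "real (w k l) < real p * (edge_density E (W k) (W l) - 2 * \<eta>) + 1"
        using that by (auto simp: w_def split: if_splits) linarith
      then show ?thesis using p by (simp add: field_simps)
    qed
    have w_ge: "real p * (edge_density E (W k) (W l) - 2 * \<eta>) \<le> real (w k l)" if "k \<noteq> l" for k l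
      using that real_nat_ceiling_ge by (simp add: w_def)
    \<comment> \<open>Outside the index range \<open>\<mu>\<close> falls back to index 0, because
      \<open>clique_in_tuple\<close> asks for a lower bound at every index.\<close>
    define \<mu> where "\<mu> k = \<sigma> * real (card (W (if k < K then k else 0)))" for k
    have \<mu>_gt: "2 ^ p * (\<epsilon> * real n) < \<eta> * \<mu> k" for k
    proof -
      have "c * real n \<le> real (card (W (if k < K then k else 0)))" using W K(2) by auto
      moreover have "c * real n > 0" using c n by simp
      ultimately have "c * real n / 2 < real (card (W (if k < K then k else 0)))" by linarith
      then have "\<eta> * \<sigma> * (c * real n / 2) < \<eta> * \<sigma> * real (card (W (if k < K then k else 0)))"
        using \<eta> \<sigma> by (intro mult_strict_left_mono) auto
      then show ?thesis by (simp add: \<epsilon>_def \<mu>_def mult_ac)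
    qed
    \<comment> \<open>Otherwise \<open>w i j + card C \<ge> s + t + 1\<close>, and the embedded
      clique has order \<open>p + w i j + card C - 2 \<ge> p + s + t - 1\<close>.\<close>
    have no_clique: "w i j + card C \<le> s + t"
      if C: "C \<subseteq> {..<K}" "\<And>k l. k \<in> C \<Longrightarrow> l \<in> C \<Longrightarrow> k \<noteq> l \<Longrightarrow> w k l > 0"
        and ij: "i \<in> C" "j \<in> C" "i \<noteq> j" for i j C
    proof (rule ccontr)
      assume big_w: "\<not> ?thesis"
      define S where "S = C - {i, j}"
      have finC: "finite C" using C(1) finite_subset by blast
      have CS: "C = insert i (insert j S)" "i \<notin> S" "j \<notin> S" "finite S"
        using ij finC by (auto simp: S_def)
      then have cardC: "card C = card S + 2" using ij(3) by simp
      have CK: "k < K" if "k \<in> C" for k using C(1) that by auto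
      have cardK: "card C \<le> K" using card_mono[OF _ C(1)] by simp
      have Xex: "\<exists>X\<subseteq>(\<Union>k\<in>insert i (insert j S). W k). finite X \<and> card X = p + w i j + card S \<and> clique X E"
      proof (rule clique_in_tuple[where \<mu> = \<mu> and R = "real K + 2" and V = "{..<n}" and \<eta> = \<eta>,
            OF CS(4,2,3) ij(3) p C(2)[OF ij] loops \<eta>(1,2) rich _ \<mu>_gt], unfold CS(1)[symmetric])
        show "0 \<le> \<epsilon> * real n" using \<epsilon> by simp
        show "real (card S) + 2 \<le> real K + 2" using cardC cardK by simp
        show "finite (W k) \<and> W k \<subseteq> {..<n}" if "k \<in> C" for k
          using W[OF CK[OF that]] finite_subset by auto
        show "(real K + 2) * \<mu> k \<le> \<eta> ^ card S * real (card (W k))" if "k \<in> C" for k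
        proof -
          have "(real K + 2) * \<mu> k = \<eta> ^ K * real (card (W k))"
            using CK[OF that] by (simp add: \<mu>_def \<sigma>_def)
          also have "\<dots> \<le> \<eta> ^ card S * real (card (W k))"
            using \<eta> cardC cardK by (intro mult_right_mono power_decreasing) auto
          finally show ?thesis .
        qed
        show "\<eta> * real (card A) * real (card B) \<le> ecount E A B"
          if "k \<in> C" "l \<in> C" "k \<noteq> l" "A \<subseteq> W k" "B \<subseteq> W l" "\<mu> k \<le> real (card A)" "\<mu> l \<le> real (card B)"
          for k l A B
        proof (rule ecount_ge_of_density)
          have "edge_density E (W k) (W l) - \<eta> \<le> edge_density E A B"
            using that CK by (intro reg) (auto simp: \<mu>_def)
          moreover have "w k l > 0" using C(2) that by blast
          then have "0 \<le> (real (w k l) - 1) / real p" by simp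
          ultimately show "\<eta> \<le> edge_density E A B" using w_pos[OF \<open>w k l > 0\<close>] by linarith
        qed
        show "((real (w i j) - 1) / real p + \<eta>) * real (card A) * real (card B) \<le> ecount E A B"
          if "A \<subseteq> W i" "B \<subseteq> W j" "\<mu> i \<le> real (card A)" "\<mu> j \<le> real (card B)" for A B
        proof (rule ecount_ge_of_density)
          have "edge_density E (W i) (W j) - \<eta> \<le> edge_density E A B"
            using that ij CK by (intro reg) (auto simp: \<mu>_def)
          then show "(real (w i j) - 1) / real p + \<eta> \<le> edge_density E A B"
            using w_pos[OF C(2)[OF ij]] by linarith
        qed
      qed
      from Xex obtain X where X: "X \<subseteq> (\<Union>k\<in>C. W k)" "finite X" "card X = p + w i j + card S" "clique X E"
        unfolding CS(1)[symmetric] by blast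
      have "p + s + t - 1 \<le> card X" using X(3) big_w cardC by simp
      then obtain Y where Y: "Y \<subseteq> X" "card Y = p + s + t - 1" "finite Y"
        by (rule obtain_subset_with_card_n)
      have "X \<subseteq> {..<n}" using X(1) W CK by blast
      then have "Y \<in> [{..<n}]\<^bsup>(p + s + t - 1)\<^esup>" using Y by (auto simp: nsets_def)
      then show False using free smaller_clique[OF X(4) Y(1)] unfolding K_free_def by blast
    qed
    \<comment> \<open>Every index gets mass 1. The admissible weight \<open>s + t - card C\<close>
      falls as the clique grows, and \<open>turan_parameter_bound\<close> settles this trade-off; a
      single index has no pairs and takes \<open>c = 0\<close>.\<close>
    have "(\<Sum>k<K. \<Sum>l<K. real (w k l) * 1 * 1) \<le> b' * (\<Sum>k<K. 1)\<^sup>2"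
    proof (rule weighted_turan)
      show "real (w k l) = real (w l k)" for k l by (simp add: w_def edge_density_commute)
      show "real (w k k) = 0" for k by (simp add: w_def)
      fix C assume C: "C \<subseteq> {..<K}" "finite C" "C \<noteq> {}"
        "\<And>k l. k \<in> C \<Longrightarrow> l \<in> C \<Longrightarrow> k \<noteq> l \<Longrightarrow> real (w k l) \<noteq> 0"
      then have pos: "w k l > 0" if "k \<in> C" "l \<in> C" "k \<noteq> l" for k l using that by fastforce
      have bd: "w k l + card C \<le> s + t" if "k \<in> C" "l \<in> C" "k \<noteq> l" for k l
        by (intro no_clique[OF C(1)] pos that)
      show "\<exists>c\<ge>0. (\<forall>k\<in>C. \<forall>l\<in>C. k \<noteq> l \<longrightarrow> real (w k l) \<le> c) \<and> c * (1 - 1 / real (card C)) \<le> b'"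
      proof (cases "\<exists>k\<in>C. \<exists>l\<in>C. k \<noteq> l")
        case True
        have cC: "card C > 0" using C by (simp add: card_gt_0_iff)
        show ?thesis
        proof (intro exI[of _ "real s + real t - real (card C)"] conjI ballI impI)
          show "0 \<le> real s + real t - real (card C)" using True bd by fastforce
          show "real (w k l) \<le> real s + real t - real (card C)" if "k \<in> C" "l \<in> C" "k \<noteq> l" for k l
            using bd[OF that] by linarith
          show "(real s + real t - real (card C)) * (1 - 1 / real (card C)) \<le> b'"
            unfolding b'_def by (rule turan_parameter_bound[OF cC t st])
        qed
      qed (use b0 in auto)
    qed (use b0 in auto)
    then have w_sum: "(\<Sum>k<K. \<Sum>l<K. real (w k l)) \<le> b' * (real K)\<^sup>2" by simp
    have pairs: "(\<Sum>k<K. \<Sum>l\<in>{..<K}-{k}. x) = real K * (real K - 1) * x" for x :: real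
      using K(2) by (simp add: of_nat_diff)
    have "real p * ((\<Sum>k<K. \<Sum>l\<in>{..<K}-{k}. edge_density E (W k) (W l)) - real K * (real K - 1) * (2 * \<eta>))
      = (\<Sum>k<K. \<Sum>l\<in>{..<K}-{k}. real p * (edge_density E (W k) (W l) - 2 * \<eta>))"
    proof -
      have "(\<Sum>k<K. \<Sum>l\<in>{..<K}-{k}. edge_density E (W k) (W l) - 2 * \<eta>)
        = (\<Sum>k<K. \<Sum>l\<in>{..<K}-{k}. edge_density E (W k) (W l)) - real K * (real K - 1) * (2 * \<eta>)"
        by (simp only: sum_subtractf pairs)
      then show ?thesis unfolding sum_distrib_left[symmetric] by (rule arg_cong[OF sym])
    qed
    also have "\<dots> \<le> (\<Sum>k<K. \<Sum>l\<in>{..<K}-{k}. real (w k l))"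
      using w_ge by (intro sum_mono) auto
    also have "\<dots> \<le> (\<Sum>k<K. \<Sum>l<K. real (w k l))"
      by (intro sum_mono sum_mono2) auto
    also have "\<dots> \<le> b' * (real K)\<^sup>2" by (rule w_sum)
    also have "b' = real p * b" using p by (simp add: b_def b'_def)
    finally have S_le: "(\<Sum>k<K. \<Sum>l\<in>{..<K}-{k}. edge_density E (W k) (W l)) - real K * (real K - 1) * (2 * \<eta>)
        \<le> b * (real K)\<^sup>2"
      using p by (simp add: mult.assoc)
    have "k * ((k - 1) * (x - d - e)) = k * (k - 1) * (x - d) - k * (k - 1) * e" for k x d e :: real
      by (simp add: algebra_simps)
    then have "real K * ((real K - 1) * (edge_density E {..<n} {..<n} - \<delta> / 4 - 2 * \<eta>))
      = real K * (real K - 1) * (edge_density E {..<n} {..<n} - \<delta> / 4) - real K * (real K - 1) * (2 * \<eta>)" .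
    also note diff_right_mono[OF sum_W]
    also note S_le
    also have "b * (real K)\<^sup>2 = real K * (b * real K)" by (simp add: power2_eq_square)
    finally have "real K * ((real K - 1) * (edge_density E {..<n} {..<n} - \<delta> / 4 - 2 * \<eta>)) \<le> real K * (b * real K)" .
    then have "(real K - 1) * (edge_density E {..<n} {..<n} - \<delta> / 4 - 2 * \<eta>) \<le> b * real K"
      using K(2) by simp
    also have "\<dots> \<le> (real K - 1) * (b + \<delta> / 2)"
    proof -
      have "b \<le> (real K - 1) * (\<delta> / 2)" using K(1) \<delta> by (simp add: field_simps)
      then show ?thesis by (simp add: algebra_simps)
    qed
    finally have "edge_density E {..<n} {..<n} - \<delta> / 4 - 2 * \<eta> \<le> b + \<delta> / 2"
      using K(2) by simp
    then have "edge_density E {..<n} {..<n} \<le> b + \<delta>" using \<eta>(3) by linarith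
    then show ?thesis
      using n by (simp add: edge_density_def ecount_self[OF G] pos_divide_le_eq power2_eq_square)
  qed
  then show ?thesis using \<epsilon> unfolding b_def by blast
qed

section \<open>Admissible graphs, their constructions, and limits of their sizes\<close>

section \<open>Existence of the limits\<close>

text \<open>All clique-free sets have at most \<open>m\<close> vertices iff every larger set
  contains a clique. For \<open>p > 0\<close> the empty set is clique-free, so the maximum is taken
  over a nonempty set.\<close>

lemma alpha_le_iff_rich:
  assumes "finite V" "p > 0"
  shows "real (alpha p V E) \<le> m \<longleftrightarrow> rich p m V E"
proof -
  let ?A = "{card U | U. U \<subseteq> V \<and> K_free p U (induced E U)}"
  have free: "K_free p U (induced E U) \<longleftrightarrow> \<not> (\<exists>Q\<subseteq>U. card Q = p \<and> clique Q E)" for U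
  proof -
    have "Q \<in> [U]\<^bsup>p\<^esup> \<and> clique Q (induced E U) \<longleftrightarrow> Q \<subseteq> U \<and> card Q = p \<and> clique Q E" for Q
      using assms(2) by (auto simp: nsets_def clique_def induced_def subset_iff intro: card_ge_0_finite)
    then show ?thesis unfolding K_free_def by blast
  qed
  have "?A \<subseteq> card ` Pow V" by auto
  then have fin: "finite ?A" using assms(1) finite_subset by blast
  have "K_free p {} (induced E {})" using assms(2) unfolding free by auto
  then have ne: "?A \<noteq> {}" by blast
  have "real (alpha p V E) \<le> m \<longleftrightarrow> (\<forall>k\<in>?A. real k \<le> m)"
    unfolding alpha_def using Max_in[OF fin ne] Max_ge[OF fin]
    by (meson of_nat_le_iff order_trans)
  also have "\<dots> \<longleftrightarrow> rich p m V E"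
    unfolding rich_def free by (auto simp: not_less[symmetric]; meson)
  finally show ?thesis .
qed

definition admissible :: "nat \<Rightarrow> nat \<Rightarrow> real \<Rightarrow> nat \<Rightarrow> nat set set \<Rightarrow> bool" where
  "admissible p q m n E \<longleftrightarrow> sgraph {..<n} E \<and> K_free q {..<n} E \<and> rich p m {..<n} E"

lemma admissible_mono: "admissible p q m n E \<Longrightarrow> m \<le> m' \<Longrightarrow> admissible p q m' n E"
  unfolding admissible_def rich_def by fastforce

lemma RT_eq_Sup_admissible:
  "p > 0 \<Longrightarrow> RT p n q m = Sup {card E | E. admissible p q m n E}"
  unfolding RT_def admissible_def by (simp add: alpha_le_iff_rich)

lemma sgraph_card_le:
  assumes "sgraph {..<n} E"
  shows "card E \<le> n\<^sup>2"
proof -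
  have "2 * real (card E) \<le> real n * real n"
    using ecount_self[OF assms] ecount_le[of E "{..<n}" "{..<n}"] by simp
  then have "real (card E) \<le> real (n * n)" by simp
  then show ?thesis by (simp only: of_nat_le_iff power2_eq_square)
qed

lemma finite_admissible_sizes: "finite {card E | E. admissible p q m n E}"
  by (rule finite_subset[of _ "{..n\<^sup>2}"]) (auto simp: admissible_def sgraph_card_le)

lemma RT_ge:
  assumes "p > 0" "admissible p q m n E"
  shows "card E \<le> RT p n q m"
  unfolding RT_eq_Sup_admissible[OF assms(1)] using assms(2) finite_admissible_sizes
  by (intro cSup_upper) (auto intro: bdd_above_finite)

lemma RT_cases:
  assumes "p > 0"
  obtains E where "admissible p q m n E" "RT p n q m = card E"
  | "RT p n q m = 0" "\<nexists>E. admissible p q m n E"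
proof (cases "\<exists>E. admissible p q m n E")
  case True
  then have ne: "{card E | E. admissible p q m n E} \<noteq> {}" by auto
  have "RT p n q m \<in> {card E | E. admissible p q m n E}"
    unfolding RT_eq_Sup_admissible[OF assms] cSup_eq_Max[OF finite_admissible_sizes ne]
    by (rule Max_in[OF finite_admissible_sizes ne])
  then show ?thesis using that(1) by auto
next
  case False
  then show ?thesis using that(2) by (simp add: RT_eq_Sup_admissible[OF assms] Sup_nat_def)
qed

lemma RT_mono:
  assumes "p > 0" "m \<le> m'"
  shows "RT p n q m \<le> RT p n q m'"
  using assms by (metis RT_cases RT_ge admissible_mono zero_le)

lemma RT_le_square: "p > 0 \<Longrightarrow> RT p n q m \<le> n\<^sup>2"
  by (metis RT_cases admissible_def sgraph_card_le zero_le)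

text \<open>Isolated vertices serve as padding. Richness is vacuous, as no subset has more than
  \<open>r\<close> elements.\<close>

lemma admissible_empty:
  assumes "q \<ge> 2"
  shows "admissible p q (real r) r {}"
proof -
  have "rich p (real r) {..<r} {}"
    unfolding rich_def
  proof (intro allI impI)
    fix X assume "X \<subseteq> {..<r}" "real r < real (card X)"
    then show "\<exists>Q\<subseteq>X. card Q = p \<and> clique Q {}"
      using card_mono[of "{..<r}" X] by simp
  qed
  moreover have "K_free q {..<r} {}"
    unfolding K_free_def
  proof
    assume "\<exists>C\<in>[{..<r}]\<^bsup>q\<^esup>. clique C {}"
    then obtain C :: "nat set" where C: "card C = q" "clique C {}" by (auto simp: nsets_def)
    obtain D where D: "D \<subseteq> C" "card D = 2"
      using obtain_subset_with_card_n[of 2 C] C(1) assms by metis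
    then obtain x y where "D = {x, y}" "x \<noteq> y" by (meson card_2_iff)
    then show False using C(2) D(1) by (auto simp: clique_def)
  qed
  ultimately show ?thesis by (simp add: admissible_def sgraph_def)
qed

text \<open>In the disjoint union a clique lies on one side, and a set of more than
  \<open>m1 + m2\<close> vertices is large on at least one side. The second graph is shifted by
  \<open>n1\<close>.\<close>

lemma admissible_union:
  assumes 1: "admissible p q m1 n1 E1" and 2: "admissible p q m2 n2 E2"
  shows "\<exists>E. admissible p q (m1 + m2) (n1 + n2) E \<and> card E1 \<le> card E"
proof -
  let ?f = "(+) n1"
  define E where "E = E1 \<union> (`) ?f ` E2"
  have E1: "e \<subseteq> {..<n1}" "card e = 2" if "e \<in> E1" for e
    using 1 that by (auto simp: admissible_def sgraph_def nsets_def)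
  have E2: "e \<subseteq> {..<n2}" "card e = 2" if "e \<in> E2" for e
    using 2 that by (auto simp: admissible_def sgraph_def nsets_def)
  have left: "{u, v} \<in> E \<longleftrightarrow> {u, v} \<in> E1" if "u < n1" for u v
  proof -
    have "{u, v} \<noteq> ?f ` x" for x using that by (metis imageE insertI1 not_add_less1)
    then show ?thesis by (auto simp: E_def)
  qed
  have right: "{?f u, ?f v} \<in> E \<longleftrightarrow> {u, v} \<in> E2" for u v
  proof -
    have "{?f u, ?f v} \<notin> E1" using E1(1)[of "{?f u, ?f v}"] by auto
    moreover have "{?f u, ?f v} = ?f ` {u, v}" by simp
    ultimately show ?thesis unfolding E_def by (auto simp: inj_image_eq_iff simp del: image_insert)
  qed
  have G: "sgraph {..<n1 + n2} E"
  proof -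
    have fin: "finite e" if "card e = 2" for e :: "nat set" using that by (simp add: card_ge_0_finite)
    have "e \<in> [{..<n1 + n2}]\<^bsup>2\<^esup>" if "e \<in> E" for e
    proof (cases "e \<in> E1")
      case True
      then show ?thesis using E1[of e] fin[of e] by (auto simp: nsets_def)
    next
      case False
      then obtain d where d: "d \<in> E2" "e = ?f ` d" using \<open>e \<in> E\<close> by (auto simp: E_def)
      then show ?thesis using E2[OF d(1)] fin[of d] by (auto simp: nsets_def card_image)
    qed
    then have "E \<subseteq> [{..<n1 + n2}]\<^bsup>2\<^esup>" by blast
    then show ?thesis unfolding sgraph_def by simp
  qed
  have cl_left: "clique C E \<longleftrightarrow> clique C E1" if "C \<subseteq> {..<n1}" for C
  proof -
    have "{u, v} \<in> E \<longleftrightarrow> {u, v} \<in> E1" if "u \<in> C" for u v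
      using left \<open>C \<subseteq> {..<n1}\<close> that by blast
    then show ?thesis unfolding clique_def by simp
  qed
  have cl_right: "clique (?f ` C) E \<longleftrightarrow> clique C E2" for C
    using right unfolding clique_def by auto
  have "K_free q {..<n1 + n2} E"
    unfolding K_free_def
  proof
    assume "\<exists>C\<in>[{..<n1 + n2}]\<^bsup>q\<^esup>. clique C E"
    then obtain C where C: "C \<subseteq> {..<n1 + n2}" "finite C" "card C = q" "clique C E"
      by (auto simp: nsets_def)
    show False
    proof (cases "C \<subseteq> {..<n1}")
      case True
      then show ?thesis using 1 C cl_left unfolding admissible_def K_free_def nsets_def by blast
    next
      case False
      then obtain v where v: "v \<in> C" "\<not> v < n1" by auto
      \<comment> \<open>An edge of \<open>E\<close> with an endpoint below \<open>n1\<close> comes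
        from \<open>E1\<close>, so a clique containing \<open>v\<close> cannot meet the first
        side.\<close>
      have ge: "u \<ge> n1" if "u \<in> C" for u
      proof (rule ccontr)
        assume u: "\<not> u \<ge> n1"
        then have "{u, v} \<in> E1" using left[of u v] C(4) that v unfolding clique_def by auto
        then show False using E1(1) v by fastforce
      qed
      define D where "D = {x. n1 + x \<in> C}"
      have CD: "C = ?f ` D"
      proof
        show "C \<subseteq> ?f ` D"
        proof
          fix u assume "u \<in> C"
          then have "u = n1 + (u - n1)" "u - n1 \<in> D" using ge by (auto simp: D_def)
          then show "u \<in> ?f ` D" by blast
        qed
      qed (auto simp: D_def)
      have "finite D" "card D = q" using C(2,3) unfolding CD by (auto simp: card_image finite_image_iff)
      moreover have "D \<subseteq> {..<n2}" using C(1) by (auto simp: D_def)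
      ultimately have "D \<in> [{..<n2}]\<^bsup>q\<^esup>" by (simp add: nsets_def)
      then show ?thesis using 2 C(4) cl_right[of D] CD unfolding admissible_def K_free_def by blast
    qed
  qed
  moreover have "rich p (m1 + m2) {..<n1 + n2} E"
    unfolding rich_def
  proof (intro allI impI)
    fix X assume X: "X \<subseteq> {..<n1 + n2}" "m1 + m2 < real (card X)"
    define X1 where "X1 = X \<inter> {..<n1}"
    define X2 where "X2 = {x. n1 + x \<in> X}"
    have eq: "X = X1 \<union> ?f ` X2"
    proof
      show "X \<subseteq> X1 \<union> ?f ` X2"
      proof
        fix u assume u: "u \<in> X"
        show "u \<in> X1 \<union> ?f ` X2"
        proof (cases "u < n1")
          case False
          then have "u = n1 + (u - n1)" "u - n1 \<in> X2" using u by (auto simp: X2_def)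
          then show ?thesis by blast
        qed (use u in \<open>simp add: X1_def\<close>)
      qed
    qed (auto simp: X1_def X2_def)
    have "finite X" using X(1) finite_subset by blast
    then have "finite X1" "finite (?f ` X2)" using eq by (metis finite_Un)+
    moreover have "X1 \<inter> ?f ` X2 = {}" by (auto simp: X1_def)
    ultimately have "card X = card X1 + card (?f ` X2)"
      by (subst eq) (rule card_Un_disjoint)
    then have "card X = card X1 + card X2" by (simp add: card_image)
    then consider "m1 < real (card X1)" | "m2 < real (card X2)" using X(2) by linarith
    then show "\<exists>Q\<subseteq>X. card Q = p \<and> clique Q E"
    proof cases
      case 1
      moreover have "X1 \<subseteq> {..<n1}" by (auto simp: X1_def)
      ultimately obtain Q where "Q \<subseteq> X1" "card Q = p" "clique Q E1"
        using assms(1) unfolding admissible_def rich_def by meson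
      moreover have "Q \<subseteq> {..<n1}" "Q \<subseteq> X" using \<open>Q \<subseteq> X1\<close> by (auto simp: X1_def)
      ultimately show ?thesis using cl_left[of Q] by blast
    next
      case 2
      moreover have "X2 \<subseteq> {..<n2}" using X(1) by (auto simp: X2_def)
      ultimately obtain Q where "Q \<subseteq> X2" "card Q = p" "clique Q E2"
        using assms(2) unfolding admissible_def rich_def by meson
      then have "?f ` Q \<subseteq> X" "card (?f ` Q) = p" "clique (?f ` Q) E"
        using cl_right[of Q] by (auto simp: X2_def card_image)
      then show ?thesis by blast
    qed
  qed
  moreover have "card E1 \<le> card E"
  proof (rule card_mono)
    show "finite E" using G finite_imp_finite_nsets finite_subset unfolding sgraph_def by blast
  qed (auto simp: E_def)
  ultimately show ?thesis using G unfolding admissible_def by blast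
qed

lemma sum_mod: "(\<Sum>u<a * n. g (u mod n)) = real a * (\<Sum>x<n. g x)" for g :: "nat \<Rightarrow> real"
proof -
  have "(\<Sum>u<a * n. g (u mod n)) = (\<Sum>i<a. \<Sum>u\<in>{i * n..<i * n + n}. g (u mod n))"
    by (rule sum.nat_group[symmetric])
  also have "\<dots> = (\<Sum>i<a. \<Sum>x<n. g x)"
  proof (rule sum.cong)
    fix i
    have "{i * n..<i * n + n} = {0 + i * n..<n + i * n}" by (simp only: add_0 add.commute)
    then have "(\<Sum>u\<in>{i * n..<i * n + n}. g (u mod n)) = (\<Sum>x\<in>{0..<n}. g ((x + i * n) mod n))"
      by (simp only: sum.shift_bounds_nat_ivl)
    also have "\<dots> = (\<Sum>x<n. g x)"
      unfolding atLeast0LessThan by (rule sum.cong) (auto simp: mod_less)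
    finally show "(\<Sum>u\<in>{i * n..<i * n + n}. g (u mod n)) = (\<Sum>x<n. g x)" .
  qed simp
  finally show ?thesis by simp
qed

text \<open>Each vertex is replaced by the \<open>a\<close> elements of its residue class modulo
  \<open>n\<close>, which are independent. Cliques project injectively, since \<open>E\<close> has
  no loops, and a set of more than \<open>a * m\<close> vertices meets more than \<open>m\<close>
  classes.\<close>

lemma admissible_blowup:
  assumes adm: "admissible p q m n E" and n: "n > 0"
  shows "\<exists>E'. admissible p q (real a * m) (a * n) E' \<and> card E' = a\<^sup>2 * card E"
proof -
  let ?V = "{..<a * n}"
  let ?f = "\<lambda>u. u mod n"
  have G: "sgraph {..<n} E" and free: "K_free q {..<n} E" and rich: "rich p m {..<n} E"
    using adm by (auto simp: admissible_def)
  have loops: "{v} \<notin> E" for v using G by (auto simp: sgraph_def nsets_def)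
  define E' where "E' = {e \<in> [?V]\<^bsup>2\<^esup>. ?f ` e \<in> E}"
  have G': "sgraph ?V E'" by (auto simp: sgraph_def E'_def)
  have edge: "{u, v} \<in> E' \<longleftrightarrow> {?f u, ?f v} \<in> E" if "u < a * n" "v < a * n" for u v
  proof (cases "u = v")
    case False
    then have "{u, v} \<in> [?V]\<^bsup>2\<^esup>" using that by (simp add: nsets_def)
    then show ?thesis by (simp add: E'_def)
  next
    case True
    have "{u, u} \<notin> E'" by (simp add: E'_def nsets_def)
    then show ?thesis using True loops by simp
  qed
  have "K_free q ?V E'"
    unfolding K_free_def
  proof
    assume "\<exists>C\<in>[?V]\<^bsup>q\<^esup>. clique C E'"
    then obtain C where C: "C \<subseteq> ?V" "finite C" "card C = q" "clique C E'"
      by (auto simp: nsets_def)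
    have e: "{?f u, ?f v} \<in> E" if "u \<in> C" "v \<in> C" "u \<noteq> v" for u v
    proof -
      have "{u, v} \<in> E'" using C(4) that unfolding clique_def by blast
      moreover have "u < a * n" "v < a * n" using C(1) that by auto
      ultimately show ?thesis using edge by blast
    qed
    have "inj_on ?f C"
    proof (rule inj_onI, rule ccontr)
      fix u v assume "u \<in> C" "v \<in> C" "?f u = ?f v" "u \<noteq> v"
      then show False using e[of u v] loops by simp
    qed
    then have "?f ` C \<in> [{..<n}]\<^bsup>q\<^esup>" using C n by (auto simp: nsets_def card_image)
    moreover have "clique (?f ` C) E"
      unfolding clique_def
    proof (intro ballI impI)
      fix x y assume "x \<in> ?f ` C" "y \<in> ?f ` C" "x \<noteq> y"
      then obtain u v where "u \<in> C" "v \<in> C" "u \<noteq> v" "x = ?f u" "y = ?f v" by blast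
      then show "{x, y} \<in> E" using e by simp
    qed
    ultimately show False using free unfolding K_free_def by blast
  qed
  moreover have "rich p (real a * m) ?V E'"
    unfolding rich_def
  proof (intro allI impI)
    fix X assume X: "X \<subseteq> ?V" "real a * m < real (card X)"
    have fibre: "card {u \<in> X. ?f u = x} \<le> a" for x
    proof -
      have "{u \<in> X. ?f u = x} \<subseteq> (\<lambda>i. i * n + x) ` {..<a}"
      proof
        fix u assume u: "u \<in> {u \<in> X. ?f u = x}"
        then have "u = u div n * n + x" using div_mult_mod_eq[of u n] by simp
        moreover have "u < a * n" using u X(1) by blast
        then have "u div n < a" by (rule less_mult_imp_div_less)
        ultimately show "u \<in> (\<lambda>i. i * n + x) ` {..<a}" by blast
      qed
      then have "card {u \<in> X. ?f u = x} \<le> card {..<a}" by (intro surj_card_le) simp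
      then show ?thesis by simp
    qed
    have finX: "finite X" using X(1) finite_subset by blast
    have "X = (\<Union>x\<in>?f ` X. {u \<in> X. ?f u = x})" by blast
    then have "card X = card (\<Union>x\<in>?f ` X. {u \<in> X. ?f u = x})" by (rule arg_cong)
    also have "\<dots> \<le> (\<Sum>x\<in>?f ` X. card {u \<in> X. ?f u = x})"
      by (intro card_UN_le finite_imageI finX)
    also have "\<dots> \<le> (\<Sum>x\<in>?f ` X. a)" using fibre by (intro sum_mono)
    finally have "card X \<le> card (?f ` X) * a" by simp
    then have "real (card X) \<le> real (card (?f ` X)) * real a"
      unfolding of_nat_mult[symmetric] of_nat_le_iff .
    then have "real a * m < real a * real (card (?f ` X))"
      using X(2) unfolding mult.commute[of "real a" "real (card (?f ` X))"] by (rule less_le_trans[rotated])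
    then have "m < real (card (?f ` X))" by (rule mult_left_less_imp_less) simp
    moreover have "?f ` X \<subseteq> {..<n}" using n by auto
    ultimately obtain Q where Q: "Q \<subseteq> ?f ` X" "card Q = p" "clique Q E"
      using rich unfolding rich_def by meson
    \<comment> \<open>\<open>?g\<close> picks one representative inside \<open>X\<close> for each
      class, which lifts the clique \<open>Q\<close> back into \<open>X\<close>.\<close>
    let ?g = "inv_into X ?f"
    have g: "?g x \<in> X" "?f (?g x) = x" if "x \<in> Q" for x
      using inv_into_into[of x ?f X] f_inv_into_f[of x ?f X] subsetD[OF Q(1) that] by simp_all
    show "\<exists>Q\<subseteq>X. card Q = p \<and> clique Q E'"
    proof (intro exI[of _ "?g ` Q"] conjI)
      show "card (?g ` Q) = p" using Q(2) card_image[OF inj_on_inv_into[OF Q(1)]] by simp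
      show "clique (?g ` Q) E'"
        unfolding clique_def
      proof (intro ballI impI)
        fix u v assume "u \<in> ?g ` Q" "v \<in> ?g ` Q" "u \<noteq> v"
        then obtain x y where xy: "x \<in> Q" "y \<in> Q" "u = ?g x" "v = ?g y" "x \<noteq> y" by blast
        have "u \<in> X" "v \<in> X" using g(1) xy(1-4) by simp_all
        then have "u < a * n" "v < a * n" using X(1) by auto
        moreover have "{?f u, ?f v} \<in> E" using Q(3) xy g(2) unfolding clique_def by simp
        ultimately show "{u, v} \<in> E'" using edge by blast
      qed
      show "?g ` Q \<subseteq> X" using g(1) by (rule image_subsetI)
    qed
  qed
  moreover have "card E' = a\<^sup>2 * card E"
  proof -
    have "2 * real (card E') = (\<Sum>u<a*n. \<Sum>v<a*n. of_bool ({?f u, ?f v} \<in> E))"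
      unfolding ecount_self[OF G', symmetric] ecount_def by (intro sum.cong refl) (simp add: edge)
    also have "\<dots> = (\<Sum>u<a*n. real a * (\<Sum>y<n. of_bool ({?f u, y} \<in> E)))"
      by (intro sum.cong refl sum_mod)
    also have "\<dots> = real a * (\<Sum>x<n. real a * (\<Sum>y<n. of_bool ({x, y} \<in> E)))"
      by (rule sum_mod)
    also have "\<dots> = real a * (real a * (2 * real (card E)))"
      unfolding ecount_self[OF G, symmetric] ecount_def by (simp add: sum_distrib_left)
    finally have "real (card E') = real (a\<^sup>2 * card E)" by (simp add: power2_eq_square)
    then show ?thesis by (simp only: of_nat_eq_iff)
  qed
  ultimately show ?thesis using G' unfolding admissible_def by blast
qed

text \<open>Write \<open>N = a * n + b * h + r\<close> with \<open>r < n\<close>, and combine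
  blow-ups of the two graphs with \<open>r\<close> isolated vertices. The slack
  \<open>b * (\<epsilon> * h - m) \<ge> n\<close> pays for the isolated vertices, and
  \<open>b\<close> does not depend on \<open>N\<close>, so \<open>k = b * h\<close> works.\<close>

lemma RT_blowup_lower_bound:
  assumes p: "p > 0" and q: "q \<ge> 2" and H: "admissible p q m h F" "m < \<epsilon> * real h"
    and G: "admissible p q (\<epsilon> * real n) n E" and n: "n > 0" and \<epsilon>: "\<epsilon> > 0"
  shows "\<exists>k. \<forall>N\<ge>k. ((N - k) div n)\<^sup>2 * card E \<le> RT p N q (\<epsilon> * real N)"
proof -
  \<comment> \<open>For \<open>h = 0\<close> the bound \<open>m\<close> would be negative, and
    richness would put a \<open>p\<close>-clique into the empty set.\<close>
  have h: "h > 0"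
  proof (rule ccontr)
    assume "\<not> h > 0"
    then have "m < 0" "h = 0" using H(2) by auto
    then obtain Q where "Q \<subseteq> {..<h}" "card Q = p"
      using H(1) unfolding admissible_def rich_def by fastforce
    then show False using p \<open>h = 0\<close> by auto
  qed
  obtain b where b: "real n \<le> real b * (\<epsilon> * real h - m)"
    using H(2) reals_Archimedean3[of "\<epsilon> * real h - m"] by (metis diff_gt_0_iff_gt less_imp_le)
  show ?thesis
  proof (intro exI[of _ "b * h"] allI impI)
    fix N assume N: "b * h \<le> N"
    define a where "a = (N - b * h) div n"
    define r where "r = (N - b * h) mod n"
    have Neq: "a * n + b * h + r = N"
      using N div_mult_mod_eq[of "N - b * h" n] unfolding a_def r_def by linarith
    have r: "r < n" using n by (simp add: r_def)
    obtain E1 where E1: "admissible p q (real a * (\<epsilon> * real n)) (a * n) E1" "card E1 = a\<^sup>2 * card E"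
      using admissible_blowup[OF G n] by blast
    obtain F1 where F1: "admissible p q (real b * m) (b * h) F1"
      using admissible_blowup[OF H(1) h] by blast
    obtain E2 where E2: "admissible p q (real a * (\<epsilon> * real n) + real b * m) (a * n + b * h) E2"
      "card E1 \<le> card E2"
      using admissible_union[OF E1(1) F1] by blast
    obtain E3 where E3: "admissible p q (real a * (\<epsilon> * real n) + real b * m + real r) N E3"
      "card E2 \<le> card E3"
      using admissible_union[OF E2(1) admissible_empty[OF q, of p r]] unfolding Neq by blast
    have "real a * (\<epsilon> * real n) + real b * m + real r \<le> \<epsilon> * real N"
    proof -
      have "real N = real a * real n + real b * real h + real r"
        unfolding Neq[symmetric] by simp
      then have "\<epsilon> * real N = real a * (\<epsilon> * real n) + real b * (\<epsilon> * real h) + \<epsilon> * real r"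
        by (simp add: algebra_simps)
      moreover have "real b * m + real r \<le> real b * (\<epsilon> * real h)"
        using b r by (simp add: algebra_simps)
      moreover have "0 \<le> \<epsilon> * real r" using \<epsilon> by simp
      ultimately show ?thesis by linarith
    qed
    then have "card E3 \<le> RT p N q (\<epsilon> * real N)"
      using RT_ge[OF p] admissible_mono[OF E3(1)] by blast
    then show "((N - b * h) div n)\<^sup>2 * card E \<le> RT p N q (\<epsilon> * real N)"
      using E1(2) E2(2) E3(2) unfolding a_def by linarith
  qed
qed

section \<open>Convergence of the normalised numbers and passage to the limit\<close>

lemma tendsto_div_ratio:
  assumes "n > 0"
  shows "(\<lambda>N. real ((N - k) div n) / real N) \<longlonglongrightarrow> 1 / real n"
proof (rule tendsto_sandwich)
  show "\<forall>\<^sub>F N in sequentially. (real N - real k - real n) / (real n * real N) \<le> real ((N - k) div n) / real N"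
    using eventually_gt_at_top[of k]
  proof eventually_elim
    case (elim N)
    have "N - k < n * ((N - k) div n) + n" using dividend_less_times_div[OF assms, of "N - k"] by simp
    then have "real (N - k) < real (n * ((N - k) div n) + n)" by (simp only: of_nat_less_iff)
    then have "real N - real k - real n \<le> real n * real ((N - k) div n)"
      using elim by (simp add: of_nat_diff)
    then have "(real N - real k - real n) / (real n * real N) \<le> (real n * real ((N - k) div n)) / (real n * real N)"
      by (intro divide_right_mono) auto
    then show ?case using assms by simp
  qed
  show "\<forall>\<^sub>F N in sequentially. real ((N - k) div n) / real N \<le> 1 / real n"
    using eventually_gt_at_top[of k]
  proof eventually_elim
    case (elim N)
    have "(N - k) div n * n \<le> N" by (meson diff_le_self div_times_less_eq_dividend le_trans)
    then have "real ((N - k) div n) * real n \<le> real N" by (metis of_nat_le_iff of_nat_mult)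
    then show ?case using assms elim by (simp add: field_simps)
  qed
  show "(\<lambda>N. (real N - real k - real n) / (real n * real N)) \<longlonglongrightarrow> 1 / real n"
    using assms by real_asymp (simp add: divide_simps)
qed auto

text \<open>The limit is the supremum: the ratio attained at any one \<open>n\<close> is carried
  over to all large \<open>N\<close> by \<open>RT_blowup_lower_bound\<close>, up to a factor tending
  to 1.\<close>

lemma RT_square_ratio_convergent:
  assumes p: "p > 0" and q: "q \<ge> 2" and H: "admissible p q m h F" "m < \<epsilon> * real h" and \<epsilon>: "\<epsilon> > 0"
  shows "convergent (\<lambda>n. real (RT p n q (\<epsilon> * real n)) / (real n)\<^sup>2)"
proof -
  define x where "x n = real (RT p n q (\<epsilon> * real n)) / (real n)\<^sup>2" for n
  have x1: "x n \<le> 1" for n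
  proof -
    have "real (RT p n q (\<epsilon> * real n)) \<le> real (n\<^sup>2)" using RT_le_square[OF p] by (simp only: of_nat_le_iff)
    then show ?thesis by (cases "n = 0") (auto simp: x_def)
  qed
  have x0: "x n \<ge> 0" for n by (simp add: x_def)
  have bdd: "bdd_above (range x)" using x1 by (intro bdd_aboveI[of _ 1]) auto
  have "x \<longlonglongrightarrow> Sup (range x)"
  proof (rule order_tendstoI)
    fix y assume "Sup (range x) < y"
    then show "\<forall>\<^sub>F N in sequentially. x N < y"
      using cSup_upper[OF _ bdd] by (intro always_eventually allI) (meson le_less_trans rangeI)
  next
    fix y assume "y < Sup (range x)"
    then obtain n where n: "y < x n" by (auto simp: less_cSup_iff[OF _ bdd])
    show "\<forall>\<^sub>F N in sequentially. y < x N"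
    proof (cases "x n = 0")
      case True
      then show ?thesis using less_le_trans[OF _ x0] n by (intro always_eventually allI) simp
    next
      case False
      then have n0: "n > 0" by (cases n) (auto simp: x_def)
      obtain E where E: "admissible p q (\<epsilon> * real n) n E" "RT p n q (\<epsilon> * real n) = card E"
        using RT_cases[OF p, of q "\<epsilon> * real n" n] False by (auto simp: x_def)
      obtain k where k: "\<And>N. N \<ge> k \<Longrightarrow> ((N - k) div n)\<^sup>2 * card E \<le> RT p N q (\<epsilon> * real N)"
        using RT_blowup_lower_bound[OF p q H E(1) n0 \<epsilon>] by blast
      have "(\<lambda>N. (real ((N - k) div n) / real N)\<^sup>2 * real (card E)) \<longlonglongrightarrow> (1 / real n)\<^sup>2 * real (card E)"
        by (intro tendsto_intros tendsto_div_ratio n0)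
      also have "(1 / real n)\<^sup>2 * real (card E) = x n"
        by (simp add: x_def E(2) power_divide)
      finally have "\<forall>\<^sub>F N in sequentially. y < (real ((N - k) div n) / real N)\<^sup>2 * real (card E)"
        using n by (rule order_tendstoD)
      then show ?thesis using eventually_ge_at_top[of k]
      proof eventually_elim
        case (elim N)
        have "real (((N - k) div n)\<^sup>2 * card E) \<le> real (RT p N q (\<epsilon> * real N))"
          using k[OF elim(2)] by (simp only: of_nat_le_iff)
        then have "real (((N - k) div n)\<^sup>2 * card E) / (real N)\<^sup>2 \<le> x N"
          unfolding x_def by (intro divide_right_mono) auto
        then show ?case using elim(1) by (simp add: power_divide)
      qed
    qed
  qed
  then show ?thesis unfolding x_def by (rule convergentI)
qed

lemma square_over_choose_two: "(\<lambda>n. (real n)\<^sup>2 / real (n choose 2)) \<longlonglongrightarrow> 2"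
proof -
  have choose: "real (n choose 2) = real n * (real n - 1) / 2" for n
    by (cases n) (simp_all add: choose_two real_of_nat_div algebra_simps)
  show ?thesis unfolding choose by real_asymp
qed

lemma RT_ratio_convergent:
  assumes "p > 0" "q \<ge> 2" "admissible p q m h F" "m < \<epsilon> * real h" "\<epsilon> > 0"
  shows "convergent (\<lambda>n. real (RT p n q (\<epsilon> * real n)) / real (n choose 2))"
proof -
  have "convergent (\<lambda>n. (real (RT p n q (\<epsilon> * real n)) / (real n)\<^sup>2) * ((real n)\<^sup>2 / real (n choose 2)))"
    by (intro convergent_mult RT_square_ratio_convergent[OF assms] convergentI[OF square_over_choose_two])
  moreover have "(real (RT p n q (\<epsilon> * real n)) / (real n)\<^sup>2) * ((real n)\<^sup>2 / real (n choose 2))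
     = real (RT p n q (\<epsilon> * real n)) / real (n choose 2)" for n
    by (cases "n = 0") auto
  ultimately show ?thesis by (simp only:)
qed

text \<open>Monotone functions bounded below converge to their infimum at the left end. Without
  this, \<open>Lim\<close> would be an unspecified value.\<close>

lemma Lim_at_right_0_le:
  fixes L :: "real \<Rightarrow> real"
  assumes mono: "\<And>x y. 0 < x \<Longrightarrow> x \<le> y \<Longrightarrow> L x \<le> L y" and nonneg: "\<And>x. x > 0 \<Longrightarrow> 0 \<le> L x"
    and le: "\<And>\<delta>. \<delta> > 0 \<Longrightarrow> \<exists>x>0. L x \<le> b + \<delta>"
  shows "Lim (at_right 0) L \<le> b"
proof -
  define I where "I = Inf (L ` {0<..})"
  have bdd: "bdd_below (L ` {0<..})" using nonneg by (intro bdd_belowI[of _ 0]) auto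
  have "(L \<longlongrightarrow> I) (at_right 0)"
  proof (rule order_tendstoI)
    fix y assume y: "y < I"
    show "\<forall>\<^sub>F x in at_right 0. y < L x"
      using eventually_at_right_less[of 0]
    proof eventually_elim
      case (elim x)
      then have "I \<le> L x" unfolding I_def by (intro cInf_lower bdd) auto
      then show ?case using y by simp
    qed
  next
    fix y assume "I < y"
    then obtain x0 where x0: "x0 > 0" "L x0 < y"
      unfolding I_def by (subst (asm) cInf_less_iff[OF _ bdd]) auto
    show "\<forall>\<^sub>F x in at_right 0. L x < y"
      using eventually_at_right_less[of 0] eventually_at_right_real[OF x0(1)]
    proof eventually_elim
      case (elim x)
      then have "L x \<le> L x0" by (intro mono) auto
      then show ?case using x0(2) by simp
    qed
  qed
  then have "Lim (at_right 0) L = I" by (intro tendsto_Lim) auto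
  moreover have "I \<le> b"
  proof (rule field_le_epsilon)
    fix \<delta> :: real assume "\<delta> > 0"
    then obtain x where x: "x > 0" "L x \<le> b + \<delta>" using le by blast
    have "I \<le> L x" unfolding I_def using x(1) by (intro cInf_lower bdd) auto
    then show "I \<le> b + \<delta>" using x(2) by simp
  qed
  ultimately show ?thesis by simp
qed

text \<open>If graphs with strict slack exist for every \<open>\<epsilon>\<close>, all inner limits
  exist and the edge bound passes to them. Otherwise, below some \<open>\<epsilon>1\<close> no
  nonempty graph is admissible, and the density is 0.\<close>

lemma RT_density_le:
  assumes p: "p > 0" and q: "q \<ge> 2" and b: "b \<ge> 0"
    and bound: "\<And>\<delta>. \<delta> > 0 \<Longrightarrow> \<exists>\<epsilon>>0. \<forall>n E. admissible p q (\<epsilon> * real n) n E \<longrightarrow>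
      2 * real (card E) \<le> (b + \<delta>) * (real n)\<^sup>2"
  shows "RT_density p q \<le> b"
proof -
  define R where "R \<epsilon> n = real (RT p n q (\<epsilon> * real n)) / real (n choose 2)" for \<epsilon> n
  have dens: "RT_density p q = Lim (at_right 0) (\<lambda>\<epsilon>. lim (R \<epsilon>))"
    unfolding RT_density_def R_def ..
  show ?thesis
  proof (cases "\<forall>\<epsilon>>0. \<exists>m h F. admissible p q m h F \<and> m < \<epsilon> * real h")
    case True
    then have conv: "R \<epsilon> \<longlonglongrightarrow> lim (R \<epsilon>)" if "\<epsilon> > 0" for \<epsilon>
      using RT_ratio_convergent[OF p q _ _ that] that unfolding R_def convergent_LIMSEQ_iff by blast
    show ?thesis unfolding dens
    proof (rule Lim_at_right_0_le)
      fix x y :: real assume xy: "0 < x" "x \<le> y"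
      have "R x n \<le> R y n" for n
        unfolding R_def using xy by (intro divide_right_mono of_nat_mono RT_mono p mult_right_mono) auto
      then show "lim (R x) \<le> lim (R y)" using conv xy by (intro LIMSEQ_le[OF conv conv]) auto
    next
      fix x :: real assume "x > 0"
      then show "0 \<le> lim (R x)" by (intro LIMSEQ_le_const[OF conv]) (auto simp: R_def)
    next
      fix \<delta> :: real assume "\<delta> > 0"
      then obtain \<epsilon> where \<epsilon>: "\<epsilon> > 0" and le: "\<And>n E. admissible p q (\<epsilon> * real n) n E \<Longrightarrow>
          2 * real (card E) \<le> (b + \<delta>) * (real n)\<^sup>2"
        using bound by blast
      \<comment> \<open>The factor \<open>1 / 2\<close> cancels against the limit 2 of
        \<open>square_over_choose_two\<close>.\<close>
      have RT_le: "real (RT p n q (\<epsilon> * real n)) \<le> (b + \<delta>) / 2 * (real n)\<^sup>2" for n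
      proof (rule RT_cases[OF p, of q "\<epsilon> * real n" n])
        fix E assume "admissible p q (\<epsilon> * real n) n E" "RT p n q (\<epsilon> * real n) = card E"
        then show ?thesis using le[of n E] by simp
      next
        assume "RT p n q (\<epsilon> * real n) = 0"
        then show ?thesis using b \<open>\<delta> > 0\<close> by simp
      qed
      have "R \<epsilon> n \<le> (b + \<delta>) / 2 * ((real n)\<^sup>2 / real (n choose 2))" for n
      proof -
        have "R \<epsilon> n \<le> ((b + \<delta>) / 2 * (real n)\<^sup>2) / real (n choose 2)"
          unfolding R_def by (intro divide_right_mono RT_le) auto
        then show ?thesis by simp
      qed
      moreover have "(\<lambda>n. (b + \<delta>) / 2 * ((real n)\<^sup>2 / real (n choose 2))) \<longlonglongrightarrow> (b + \<delta>) / 2 * 2"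
        by (intro tendsto_intros square_over_choose_two)
      ultimately have "lim (R \<epsilon>) \<le> (b + \<delta>) / 2 * 2"
        by (intro LIMSEQ_le[OF conv[OF \<epsilon>]]) auto
      then show "\<exists>x>0. lim (R x) \<le> b + \<delta>" using \<epsilon> by auto
    qed
  next
    case False
    then obtain \<epsilon>1 where \<epsilon>1: "\<epsilon>1 > 0" and none: "\<And>m h F. admissible p q m h F \<Longrightarrow> \<epsilon>1 * real h \<le> m"
      by (meson not_less)
    have zero: "lim (R \<epsilon>) = 0" if \<epsilon>: "0 < \<epsilon>" "\<epsilon> < \<epsilon>1" for \<epsilon>
    proof -
      have "R \<epsilon> n = 0" for n
      \<comment> \<open>The slack argument needs \<open>n > 0\<close>; at \<open>n = 0\<close> the
        ratio is 0 because its denominator vanishes.\<close>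
      proof (cases "n = 0")
        case False
        have "\<not> admissible p q (\<epsilon> * real n) n E" for E
          using none[of "\<epsilon> * real n" n E] \<epsilon> False by auto
        then have "RT p n q (\<epsilon> * real n) = 0" using RT_cases[OF p] by metis
        then show ?thesis by (simp add: R_def)
      qed (simp add: R_def)
      then have "R \<epsilon> = (\<lambda>_. 0)" by auto
      then show ?thesis by simp
    qed
    have "((\<lambda>\<epsilon>. lim (R \<epsilon>)) \<longlongrightarrow> 0) (at_right 0)"
    proof (rule tendsto_eventually)
      show "\<forall>\<^sub>F \<epsilon> in at_right 0. lim (R \<epsilon>) = 0"
        using eventually_at_right_real[OF \<epsilon>1] by eventually_elim (auto intro: zero)
    qed
    then have "Lim (at_right 0) (\<lambda>\<epsilon>. lim (R \<epsilon>)) = 0" by (intro tendsto_Lim) auto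
    then show ?thesis using b by (simp add: dens)
  qed
qed

theorem theorem1p5:
  fixes p s t :: nat
  assumes "p > 0" and "s > 0" and "t > 0"
    and "int t * (int t - 2) \<le> int s" and "s \<le> t\<^sup>2"
    and "s + t - 1 \<le> p"
  shows "RT_density p (p + s + t - 1) \<le> real s / real p * (1 - 1 / real t)"
proof (rule RT_density_le)
  show "p > 0" by fact
  show "2 \<le> p + s + t - 1" using assms(1-3) by linarith
  show "0 \<le> real s / real p * (1 - 1 / real t)" using assms(3) by simp
qed (use edges_bound[OF assms(1,3,4,5)] in \<open>simp only: admissible_def simp_thms imp_conjL\<close>)

end
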